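(* Let $S$ be a Polish space with Borel $\sigma$-field $\mathcal S$ and let $(Y_n)_{n\ge0}$ be an exchangeable sequence of $S$-valued random variables. Then $(Y_n)$ is a countable mixture of i.i.d. sequences if and only if $(Y_n)$ is a hidden Markov model with recurrent underlying Markov chain.
   Context: "Countable" includes finite. Exchangeability: $(Y_n)_{n\ge0}$ is exchangeable if for any $N\in\mathbb N$ and any distinct indices $m_1,\dots,m_N\ge 0$, $(Y_{m_1},\dots,Y_{m_N})$ has the same law as $(Y_0,\dots,Y_{N-1})$. Mixtures of i.i.d. sequences: let $\mathcal M_{\mathcal S}$ be the set of probability measures on $(S,\mathcal S)$, with the $\sigma$-field generated by the maps $p\mapsto p(A)$, $A\in\mathcal S$. $(Y_n)$ is a mixture of i.i.d. sequences if there is a random probability measure $\widetilde p$ (a random element of $\mathcal M_{\mathcal S}$) such that for any $N$ and $A_0,\dots,A_N\in\mathcal S$, $\mathbb P(Y_0\in A_0,\dots,Y_N\in A_N\mid\widetilde p)=\widetilde p(A_0)\cdots\widetilde p(A_N)$ $\mathbb P$-a.s. The mixture is countable if $\widetilde p$ is concentrated on a countable subset of $\mathcal M_{\mathcal S}$. Hidden Markov model (HMM): $(Y_n)_{n\ge0}$ is an HMM if there is a pair of processes $(X_n,\widetilde Y_n)_{n\ge 0}$ with values in $\mathcal X\times S$, $\mathcal X$ a discrete (countable) space, such that (1) $(X_n)$ is a time homogeneous Markov chain on $\mathcal X$ (the underlying Markov chain); (2) for all $N$ and $S_0,\dots,S_N\in\mathcal S$, $\mathbb P(\widetilde Y_0\in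 S_0,\dots,\widetilde Y_N\in S_N\mid X_0^N=x_0^N)=\prod_{n=0}^N\mathbb P(\widetilde Y_n\in S_n\mid X_n=x_n)$, where the read-out distributions $f_x(\bar S)=\mathbb P(\widetilde Y_n\in\bar S\mid X_n=x)$ do not depend on $n$; (3) $(Y_n)$ and $(\widetilde Y_n)$ have the same finite-dimensional distributions. Recurrence: a time homogeneous Markov chain $(X_n)_{n\ge 0}$ is called recurrent if $\mathbb P(X_n=x\text{ for infinitely many }n\mid X_1=x)=1$ for all $x\in\mathcal X$ such that $\mathbb P(X_1=x)>0$. *)

theory Defs
  imports "HOL-Probability.Probability"
begin

definition exchangeable :: "'w measure \<Rightarrow> 's measure \<Rightarrow> (nat \<Rightarrow> 'w \<Rightarrow> 's) \<Rightarrow> bool" where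
  "exchangeable M S Y \<longleftrightarrow>
     (\<forall>N (m :: nat \<Rightarrow> nat). inj_on m {..<N} \<longrightarrow>
        distr M (PiM {..<N} (\<lambda>_. S)) (\<lambda>\<omega>. \<lambda>i\<in>{..<N}. Y (m i) \<omega>) =
        distr M (PiM {..<N} (\<lambda>_. S)) (\<lambda>\<omega>. \<lambda>i\<in>{..<N}. Y i \<omega>))"

text \<open>
  The probability measures on \<open>S\<close> with the \<open>\<sigma>\<close>-field generated by the evaluation maps are
  \<^term>\<open>prob_algebra S\<close>.  Conditioning on \<open>p\<close> is conditioning on the \<open>\<sigma>\<close>-field \<open>\<sigma>(p)\<close>,
  that is, on the \<^const>\<open>vimage_algebra\<close> below.
\<close>

definition iid_mixture_by ::
  "'w measure \<Rightarrow> 's measure \<Rightarrow> (nat \<Rightarrow> 'w \<Rightarrow> 's) \<Rightarrow> ('w \<Rightarrow> 's measure) \<Rightarrow> bool" where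
  "iid_mixture_by M S Y p \<longleftrightarrow>
     p \<in> measurable M (prob_algebra S) \<and>
     (\<forall>N A. (\<forall>i\<le>N. A i \<in> sets S) \<longrightarrow>
        (AE \<omega> in M.
           real_cond_exp M (vimage_algebra (space M) p (prob_algebra S))
             (indicator {\<omega> \<in> space M. \<forall>i\<le>N. Y i \<omega> \<in> A i}) \<omega>
           = (\<Prod>i\<le>N. measure (p \<omega>) (A i))))"

definition countable_iid_mixture ::
  "'w measure \<Rightarrow> 's measure \<Rightarrow> (nat \<Rightarrow> 'w \<Rightarrow> 's) \<Rightarrow> bool" where
  "countable_iid_mixture M S Y \<longleftrightarrow>
     (\<exists>p. iid_mixture_by M S Y p \<and>
       (\<exists>C. C \<subseteq> space (prob_algebra S) \<and> countable C \<and> (AE \<omega> in M. p \<omega> \<in> C)))"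

text \<open>
  All elementary conditional probabilities below are only constrained when the conditioning event
  has positive probability.
\<close>

definition homogeneous_markov_chain ::
  "'w measure \<Rightarrow> 'x set \<Rightarrow> (nat \<Rightarrow> 'w \<Rightarrow> 'x) \<Rightarrow> bool" where
  "homogeneous_markov_chain M XX X \<longleftrightarrow>
     countable XX \<and>
     (\<forall>n. X n \<in> measurable M (count_space XX)) \<and>
     (\<exists>K :: 'x \<Rightarrow> 'x pmf. (\<forall>x\<in>XX. set_pmf (K x) \<subseteq> XX) \<and>
       (\<forall>n x y. (\<forall>i\<le>n. x i \<in> XX) \<longrightarrow> y \<in> XX \<longrightarrow>
          \<P>(\<omega> in M. \<forall>i\<le>n. X i \<omega> = x i) > 0 \<longrightarrow>
          \<P>(\<omega> in M. X (Suc n) \<omega> = y \<bar> \<forall>i\<le>n. X i \<omega> = x i) = pmf (K (x n)) y))"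

definition recurrent_chain ::
  "'w measure \<Rightarrow> 'x set \<Rightarrow> (nat \<Rightarrow> 'w \<Rightarrow> 'x) \<Rightarrow> bool" where
  "recurrent_chain M XX X \<longleftrightarrow>
     (\<forall>x\<in>XX. \<P>(\<omega> in M. X 1 \<omega> = x) > 0 \<longrightarrow>
        \<P>(\<omega> in M. infinite {n. X n \<omega> = x} \<bar> X 1 \<omega> = x) = 1)"

text \<open>\<open>f x\<close> is the read-out distribution of the state \<open>x\<close>.\<close>

definition hidden_markov_pair ::
  "'w measure \<Rightarrow> 's measure \<Rightarrow> 'x set \<Rightarrow> (nat \<Rightarrow> 'w \<Rightarrow> 'x) \<Rightarrow> (nat \<Rightarrow> 'w \<Rightarrow> 's) \<Rightarrow> bool" where
  "hidden_markov_pair M S XX X Y \<longleftrightarrow>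
     prob_space M \<and>
     homogeneous_markov_chain M XX X \<and>
     (\<forall>n. Y n \<in> measurable M S) \<and>
     (\<forall>N x B. (\<forall>i\<le>N. x i \<in> XX) \<longrightarrow> (\<forall>i\<le>N. B i \<in> sets S) \<longrightarrow>
        \<P>(\<omega> in M. \<forall>i\<le>N. X i \<omega> = x i) > 0 \<longrightarrow>
        \<P>(\<omega> in M. \<forall>i\<le>N. Y i \<omega> \<in> B i \<bar> \<forall>i\<le>N. X i \<omega> = x i) =
          (\<Prod>i\<le>N. \<P>(\<omega> in M. Y i \<omega> \<in> B i \<bar> X i \<omega> = x i))) \<and>
     (\<exists>f :: 'x \<Rightarrow> 's measure. (\<forall>x\<in>XX. f x \<in> space (prob_algebra S)) \<and>
       (\<forall>n. \<forall>x\<in>XX. \<forall>B\<in>sets S. \<P>(\<omega> in M. X n \<omega> = x) > 0 \<longrightarrow>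
          \<P>(\<omega> in M. Y n \<omega> \<in> B \<bar> X n \<omega> = x) = measure (f x) B))"

definition same_fdd ::
  "'s measure \<Rightarrow> 'w measure \<Rightarrow> (nat \<Rightarrow> 'w \<Rightarrow> 's) \<Rightarrow> 'v measure \<Rightarrow> (nat \<Rightarrow> 'v \<Rightarrow> 's) \<Rightarrow> bool" where
  "same_fdd S M Y M' Y' \<longleftrightarrow>
     (\<forall>N. distr M (PiM {..N} (\<lambda>_. S)) (\<lambda>\<omega>. \<lambda>i\<in>{..N}. Y i \<omega>) =
          distr M' (PiM {..N} (\<lambda>_. S)) (\<lambda>\<omega>. \<lambda>i\<in>{..N}. Y' i \<omega>))"

text \<open>
  HOL cannot quantify existentially over types, so the state space is taken to be a (countable) set
  of natural numbers and the probability space carrying the pair has paths as its points.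
  This is no restriction: see \<open>recurrent_hmmI\<close> below, where both types are arbitrary.
\<close>

definition recurrent_hmm :: "'w measure \<Rightarrow> 's measure \<Rightarrow> (nat \<Rightarrow> 'w \<Rightarrow> 's) \<Rightarrow> bool" where
  "recurrent_hmm M S Y \<longleftrightarrow>
     (\<exists>(M' :: (nat \<Rightarrow> nat \<times> 's) measure) (XX :: nat set) X Y'.
        hidden_markov_pair M' S XX X Y' \<and> recurrent_chain M' XX X \<and> same_fdd S M Y M' Y')"

lemma recurrent_hmmI:
  fixes M :: "'w measure" and M' :: "'v measure" and XX :: "'x set" and S :: "'s measure"
  assumes hmp: "hidden_markov_pair M' S XX X Y'"
    and rec: "recurrent_chain M' XX X"
    and fdd: "same_fdd S M Y M' Y'"
  shows "recurrent_hmm M S Y"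
proof -
  have prob: "prob_space M'" and mc: "homogeneous_markov_chain M' XX X"
    and Ym[measurable]: "\<And>n. Y' n \<in> measurable M' S"
    using hmp by (auto simp: hidden_markov_pair_def)
  have c: "countable XX" and Xm0: "\<And>n. X n \<in> measurable M' (count_space XX)"
    using mc by (auto simp: homogeneous_markov_chain_def)
  interpret prob_space M' by fact
  define J where "J = to_nat_on XX"
  define R where "R = from_nat_into XX"
  have inj: "inj_on J XX" unfolding J_def using c by (rule inj_on_to_nat_on)
  have RJ: "R (J x) = x" if "x \<in> XX" for x
    unfolding R_def J_def using c that by (rule from_nat_into_to_nat_on)
  have XinXX: "X n \<omega> \<in> XX" if "\<omega> \<in> space M'" for n \<omega>
    using measurable_space[OF Xm0 that] by simp
  define Q where "Q = PiM (UNIV :: nat set) (\<lambda>_. count_space (J ` XX) \<Otimes>\<^sub>M S)"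
  define \<phi> where "\<phi> = (\<lambda>\<omega> n. (J (X n \<omega>), Y' n \<omega>))"
  define P where "P = distr M' Q \<phi>"
  define X2 :: "nat \<Rightarrow> (nat \<Rightarrow> nat \<times> 's) \<Rightarrow> nat" where "X2 = (\<lambda>n w. fst (w n))"
  define Y2 :: "nat \<Rightarrow> (nat \<Rightarrow> nat \<times> 's) \<Rightarrow> 's" where "Y2 = (\<lambda>n w. snd (w n))"
  have JX: "(\<lambda>\<omega>. J (X n \<omega>)) \<in> measurable M' (count_space (J ` XX))" for n
    by (rule measurable_compose[OF Xm0]) auto
  have phi[measurable]: "\<phi> \<in> measurable M' Q"
    unfolding Q_def \<phi>_def
    by (rule measurable_PiM_single') (auto intro!: measurable_Pair JX Ym
         simp: space_pair_measure XinXX measurable_space[OF Ym])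
  have comp: "(\<lambda>w. w n) \<in> measurable Q (count_space (J ` XX) \<Otimes>\<^sub>M S)" for n
    unfolding Q_def by (rule measurable_component_singleton) simp
  have X2m: "X2 n \<in> measurable Q (count_space (J ` XX))" for n
    unfolding X2_def using comp measurable_fst by (rule measurable_compose)
  have Y2m[measurable]: "Y2 n \<in> measurable Q S" for n
    unfolding Y2_def using comp measurable_snd by (rule measurable_compose)
  have X2m'[measurable]: "X2 n \<in> measurable Q (count_space UNIV)" for n
    using X2m by (rule measurable_compose) auto
  have X2phi: "X2 n (\<phi> \<omega>) = J (X n \<omega>)" and Y2phi: "Y2 n (\<phi> \<omega>) = Y' n \<omega>" for n \<omega>
    by (auto simp: X2_def Y2_def \<phi>_def)
  have eqJ: "J (X n \<omega>) = x \<longleftrightarrow> X n \<omega> = R x" if "x \<in> J ` XX" "\<omega> \<in> space M'" for n \<omega> x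
    using that XinXX[OF that(2)] RJ by (metis imageE)
  have Rin: "R x \<in> XX" if "x \<in> J ` XX" for x
    using that RJ by auto
  have pr: "\<P>(w in P. A w) = \<P>(\<omega> in M'. B \<omega>)"
    if [measurable]: "Measurable.pred Q A" and "\<And>\<omega>. \<omega> \<in> space M' \<Longrightarrow> A (\<phi> \<omega>) \<longleftrightarrow> B \<omega>" for A B
  proof -
    have "{w \<in> space P. A w} = {w \<in> space Q. A w}" by (simp add: P_def)
    moreover have "{w \<in> space Q. A w} \<in> sets Q" by measurable
    ultimately have "\<P>(w in P. A w) = measure M' (\<phi> -` {w \<in> space Q. A w} \<inter> space M')"
      by (simp add: P_def measure_distr)
    also have "\<phi> -` {w \<in> space Q. A w} \<inter> space M' = {\<omega> \<in> space M'. B \<omega>}"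
      using that(2) measurable_space[OF phi] by auto
    finally show ?thesis .
  qed
  have cpr: "\<P>(w in P. A w \<bar> C w) = \<P>(\<omega> in M'. B \<omega> \<bar> D \<omega>)"
    if [measurable]: "Measurable.pred Q A" "Measurable.pred Q C"
    and "\<And>\<omega>. \<omega> \<in> space M' \<Longrightarrow> A (\<phi> \<omega>) \<longleftrightarrow> B \<omega>"
      "\<And>\<omega>. \<omega> \<in> space M' \<Longrightarrow> C (\<phi> \<omega>) \<longleftrightarrow> D \<omega>" for A B C D
    unfolding cond_prob_def
    by (intro arg_cong2[where f="(/)"] pr) (use that in auto)
  have mX: "Measurable.pred Q (\<lambda>w. X2 n w = x)" for n x by measurable
  have mXs: "Measurable.pred Q (\<lambda>w. \<forall>i\<le>n. X2 i w = x i)" for n x by measurable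
  have mY: "Measurable.pred Q (\<lambda>w. Y2 n w \<in> B)" if [measurable]: "B \<in> sets S" for n B by measurable
  have mYs: "Measurable.pred Q (\<lambda>w. \<forall>i\<le>n. Y2 i w \<in> B i)" if "\<forall>i\<le>n. B i \<in> sets S" for n B
    by (intro pred_intros_countable_bounded pred_intros_countable pred_intros_imp' mY)
       (use that in auto)
  have mI: "Measurable.pred Q (\<lambda>w. infinite {n. X2 n w = x})" for x
    unfolding infinite_nat_iff_unbounded mem_Collect_eq by measurable
  have m_le: "(\<forall>i\<le>n. X2 i (\<phi> \<omega>) = x i) \<longleftrightarrow> (\<forall>i\<le>n. X i \<omega> = R (x i))"
    if "\<forall>i\<le>n. x i \<in> J ` XX" "\<omega> \<in> space M'" for n x \<omega>
    using that by (auto simp: X2phi eqJ)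
  have sp: "prob_space P" unfolding P_def by (rule prob_space_distr) fact
  obtain K where K: "\<forall>x\<in>XX. set_pmf (K x) \<subseteq> XX"
    and K2: "\<And>n x y. (\<forall>i\<le>n. x i \<in> XX) \<Longrightarrow> y \<in> XX \<Longrightarrow>
          \<P>(\<omega> in M'. \<forall>i\<le>n. X i \<omega> = x i) > 0 \<Longrightarrow>
          \<P>(\<omega> in M'. X (Suc n) \<omega> = y \<bar> \<forall>i\<le>n. X i \<omega> = x i) = pmf (K (x n)) y"
    using mc unfolding homogeneous_markov_chain_def by blast
  have "homogeneous_markov_chain P (J ` XX) X2"
    unfolding homogeneous_markov_chain_def
  proof (intro conjI allI exI[of _ "\<lambda>m. map_pmf J (K (R m))"] ballI impI)
    show "countable (J ` XX)" using c by simp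
    show "X2 n \<in> measurable P (count_space (J ` XX))" for n
      using X2m[of n] by (simp add: P_def)
    show "set_pmf (map_pmf J (K (R x))) \<subseteq> J ` XX" if "x \<in> J ` XX" for x
      using K Rin[OF that] by auto
    fix n x y
    assume x: "\<forall>i\<le>n. x i \<in> J ` XX" and y: "y \<in> J ` XX"
      and pos: "\<P>(\<omega> in P. \<forall>i\<le>n. X2 i \<omega> = x i) > 0"
    have 1: "\<P>(\<omega> in P. \<forall>i\<le>n. X2 i \<omega> = x i) = \<P>(\<omega> in M'. \<forall>i\<le>n. X i \<omega> = R (x i))"
      by (rule pr[OF mXs m_le[OF x]])
    have "\<P>(\<omega> in P. X2 (Suc n) \<omega> = y \<bar> \<forall>i\<le>n. X2 i \<omega> = x i)
        = \<P>(\<omega> in M'. X (Suc n) \<omega> = R y \<bar> \<forall>i\<le>n. X i \<omega> = R (x i))"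
      by (rule cpr[OF mX mXs _ m_le[OF x]]) (simp_all add: X2phi eqJ y)
    also have "\<dots> = pmf (K (R (x n))) (R y)"
      using K2[of n "\<lambda>i. R (x i)" "R y"] x y pos Rin unfolding 1 by auto
    also have "\<dots> = pmf (map_pmf J (K (R (x n)))) y"
    proof -
      have sub: "set_pmf (K (R (x n))) \<subseteq> XX" using K Rin x by auto
      have yJ: "y = J (R y)" using y RJ by auto
      have "pmf (map_pmf J (K (R (x n)))) y = measure (measure_pmf (K (R (x n)))) (J -` {y})"
        by (simp add: pmf_map)
      also have "\<dots> = measure (measure_pmf (K (R (x n)))) {R y}"
        by (rule measure_pmf.finite_measure_eq_AE)
           (use sub yJ RJ in \<open>auto simp: AE_measure_pmf_iff\<close>)
      finally show ?thesis by (simp add: pmf.rep_eq)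
    qed
    finally show "\<P>(\<omega> in P. X2 (Suc n) \<omega> = y \<bar> \<forall>i\<le>n. X2 i \<omega> = x i)
        = pmf (map_pmf J (K (R (x n)))) y" .
  qed
  moreover obtain f where f: "\<forall>x\<in>XX. f x \<in> space (prob_algebra S)"
    and f2: "\<And>n x B. x \<in> XX \<Longrightarrow> B \<in> sets S \<Longrightarrow> \<P>(\<omega> in M'. X n \<omega> = x) > 0 \<Longrightarrow>
          \<P>(\<omega> in M'. Y' n \<omega> \<in> B \<bar> X n \<omega> = x) = measure (f x) B"
    using hmp unfolding hidden_markov_pair_def by blast
  have one: "\<P>(\<omega> in P. Y2 n \<omega> \<in> B \<bar> X2 n \<omega> = x) = \<P>(\<omega> in M'. Y' n \<omega> \<in> B \<bar> X n \<omega> = R x)"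
    if "x \<in> J ` XX" "B \<in> sets S" for n x B
    by (rule cpr[OF mY mX]) (simp_all add: X2phi Y2phi eqJ that)
  have prod: "\<P>(\<omega> in P. \<forall>i\<le>N. Y2 i \<omega> \<in> B i \<bar> \<forall>i\<le>N. X2 i \<omega> = x i) =
          (\<Prod>i\<le>N. \<P>(\<omega> in P. Y2 i \<omega> \<in> B i \<bar> X2 i \<omega> = x i))"
    if x: "\<forall>i\<le>N. x i \<in> J ` XX" and B: "\<forall>i\<le>N. B i \<in> sets S"
      and pos: "\<P>(\<omega> in P. \<forall>i\<le>N. X2 i \<omega> = x i) > 0" for N x B
  proof -
    have 1: "\<P>(\<omega> in P. \<forall>i\<le>N. X2 i \<omega> = x i) = \<P>(\<omega> in M'. \<forall>i\<le>N. X i \<omega> = R (x i))"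
      by (rule pr[OF mXs m_le[OF x]])
    have "\<P>(\<omega> in P. \<forall>i\<le>N. Y2 i \<omega> \<in> B i \<bar> \<forall>i\<le>N. X2 i \<omega> = x i)
        = \<P>(\<omega> in M'. \<forall>i\<le>N. Y' i \<omega> \<in> B i \<bar> \<forall>i\<le>N. X i \<omega> = R (x i))"
      by (rule cpr[OF mYs[OF B] mXs _ m_le[OF x]]) (simp_all add: Y2phi)
    also have "\<dots> = (\<Prod>i\<le>N. \<P>(\<omega> in M'. Y' i \<omega> \<in> B i \<bar> X i \<omega> = R (x i)))"
    proof -
      have "\<And>N x B. (\<forall>i\<le>N. x i \<in> XX) \<Longrightarrow> (\<forall>i\<le>N. B i \<in> sets S) \<Longrightarrow>
        \<P>(\<omega> in M'. \<forall>i\<le>N. X i \<omega> = x i) > 0 \<Longrightarrow>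
        \<P>(\<omega> in M'. \<forall>i\<le>N. Y' i \<omega> \<in> B i \<bar> \<forall>i\<le>N. X i \<omega> = x i) =
          (\<Prod>i\<le>N. \<P>(\<omega> in M'. Y' i \<omega> \<in> B i \<bar> X i \<omega> = x i))"
        using hmp unfolding hidden_markov_pair_def by blast
      from this[of N "\<lambda>i. R (x i)" B] show ?thesis
        using x B pos Rin unfolding 1 by auto
    qed
    also have "\<dots> = (\<Prod>i\<le>N. \<P>(\<omega> in P. Y2 i \<omega> \<in> B i \<bar> X2 i \<omega> = x i))"
      by (intro prod.cong refl) (use one x B in auto)
    finally show ?thesis .
  qed
  have rdo: "\<P>(\<omega> in P. Y2 n \<omega> \<in> B \<bar> X2 n \<omega> = x) = measure (f (R x)) B"
    if "x \<in> J ` XX" "B \<in> sets S" "\<P>(\<omega> in P. X2 n \<omega> = x) > 0" for n x B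
  proof -
    have "\<P>(\<omega> in P. X2 n \<omega> = x) = \<P>(\<omega> in M'. X n \<omega> = R x)"
      by (rule pr[OF mX]) (simp add: X2phi eqJ that)
    then show ?thesis using that one[OF that(1,2)] f2[OF Rin[OF that(1)] that(2)] by simp
  qed
  have Y2P: "\<forall>n. Y2 n \<in> measurable P S"
    using Y2m by (simp add: P_def)
  have fR: "\<forall>x\<in>J ` XX. f (R x) \<in> space (prob_algebra S)" using f Rin by blast
  have "hidden_markov_pair P S (J ` XX) X2 Y2"
    unfolding hidden_markov_pair_def
    by (intro conjI sp calculation Y2P exI[of _ "\<lambda>x. f (R x)"] fR) (use prod rdo in blast)+
  moreover have "recurrent_chain P (J ` XX) X2"
    unfolding recurrent_chain_def
  proof (intro ballI impI)
    fix x assume x: "x \<in> J ` XX" and pos: "\<P>(\<omega> in P. X2 1 \<omega> = x) > 0"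
    have "\<P>(\<omega> in P. X2 1 \<omega> = x) = \<P>(\<omega> in M'. X 1 \<omega> = R x)"
      by (rule pr[OF mX]) (simp add: X2phi eqJ x)
    moreover have "\<P>(\<omega> in P. infinite {n. X2 n \<omega> = x} \<bar> X2 1 \<omega> = x)
        = \<P>(\<omega> in M'. infinite {n. X n \<omega> = R x} \<bar> X 1 \<omega> = R x)"
      by (rule cpr[OF mI mX]) (simp_all add: X2phi eqJ x)
    ultimately show "\<P>(\<omega> in P. infinite {n. X2 n \<omega> = x} \<bar> X2 1 \<omega> = x) = 1"
      using rec pos Rin[OF x] unfolding recurrent_chain_def by simp
  qed
  moreover have "same_fdd S M Y P Y2"
    unfolding same_fdd_def
  proof
    fix N
    have m: "(\<lambda>w. \<lambda>i\<in>{..N}. Y2 i w) \<in> measurable Q (PiM {..N} (\<lambda>_. S))" by measurable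
    have "distr P (PiM {..N} (\<lambda>_. S)) (\<lambda>w. \<lambda>i\<in>{..N}. Y2 i w)
        = distr M' (PiM {..N} (\<lambda>_. S)) (\<lambda>\<omega>. \<lambda>i\<in>{..N}. Y' i \<omega>)"
      unfolding P_def distr_distr[OF m phi] by (simp add: comp_def Y2phi)
    then show "distr M (PiM {..N} (\<lambda>_. S)) (\<lambda>\<omega>. \<lambda>i\<in>{..N}. Y i \<omega>)
        = distr P (PiM {..N} (\<lambda>_. S)) (\<lambda>w. \<lambda>i\<in>{..N}. Y2 i w)"
      using fdd unfolding same_fdd_def by simp
  qed
  ultimately show ?thesis unfolding recurrent_hmm_def by blast
qed

end

theory Submission
  imports Defs
begin

text \<open>
  A countable mixture is a hidden Markov model whose chain is constant and equal to the directing
  measure, and a constant chain is recurrent.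

  Conversely, let \<open>L\<^sub>A\<close> be the limiting frequency of \<open>A\<close> along an exchangeable sequence; as in
  de Finetti's theorem, the sequence is i.i.d. given the \<open>L\<^sub>A\<close>. Suppose the sequence is generated by a
  recurrent hidden chain. On \<open>X\<^sub>1 = x\<close> the chain returns to \<open>x\<close> after any given time \<open>i\<close>, and \<open>L\<^sub>A\<close>
  depends only on what happens after the return; so, conditionally on \<open>X\<^sub>1 = x\<close>, \<open>L\<^sub>A\<close> is uncorrelated
  with the indicator of \<open>Y\<^sub>i \<in> A\<close>. Averaging over \<open>i\<close> shows that \<open>L\<^sub>A\<close> is uncorrelated with itself,
  hence almost surely equal to a constant \<open>\<nu>\<^sub>x(A)\<close> on \<open>X\<^sub>1 = x\<close>. The directing measure thus takes
  values in the countable set of the \<open>\<nu>\<^sub>x\<close>.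
\<close>

section \<open>Limiting frequencies\<close>

text \<open>The hidden chain lives on some \<open>M'\<close>, whereas the directing measure must be
  a function on \<open>M\<close>. The common law \<open>Q\<close> of the two observed sequences is
  the bridge, so the directing measure is built as a functional of the observed sequence alone. A
  second obstacle is that statements about \<open>L\<^sub>A\<close> hold off null sets depending on
  \<open>A\<close>, so at a fixed sequence \<open>L\<^sub>A\<close> need not be a measure in
  \<open>A\<close>. Each \<open>\<nu> x\<close> is therefore obtained by averaging
  \<open>L\<^sub>A\<close> over the event \<open>X 1 = x\<close>, and countably many test sets tell
  the countably many \<open>\<nu> x\<close> apart. Time 1 enters because recurrence concerns the
  states possible at time 1; a state possible only at time 0 may be transient, but
  \<open>L\<^sub>A\<close> ignores finite beginnings. A return to \<open>x\<close> after time
  \<open>i\<close> puts the observation at time \<open>i\<close> strictly before a visit to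
  \<open>x\<close>, where the Markov property separates it from all later observations.\<close>

definition emp_freq :: "'s set \<Rightarrow> nat \<Rightarrow> (nat \<Rightarrow> 's) \<Rightarrow> real" where
  "emp_freq A n s = (\<Sum>i<n. indicator A (s i)) / real n"

text \<open>Along the powers of 4 a second moment bound already gives almost sure convergence.\<close>

definition lim_freq :: "'s set \<Rightarrow> (nat \<Rightarrow> 's) \<Rightarrow> real" where
  "lim_freq A s =
     (if convergent (\<lambda>k. emp_freq A (4 ^ k) s) then lim (\<lambda>k. emp_freq A (4 ^ k) s) else 0)"

lemma emp_freq_nonneg: "0 \<le> emp_freq A n s"
  by (auto simp: emp_freq_def intro!: divide_nonneg_nonneg sum_nonneg)

lemma emp_freq_le_1: "emp_freq A n s \<le> 1"
proof -
  have "(\<Sum>i<n. indicator A (s i) :: real) \<le> (\<Sum>i<n. 1)"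
    by (intro sum_mono) (auto simp: indicator_def)
  then show ?thesis by (auto simp: emp_freq_def divide_le_eq)
qed

lemma lim_freq_tendsto:
  "convergent (\<lambda>k. emp_freq A (4 ^ k) s) \<Longrightarrow> (\<lambda>k. emp_freq A (4 ^ k) s) \<longlonglongrightarrow> lim_freq A s"
  by (simp add: lim_freq_def convergent_LIMSEQ_iff)

lemma lim_freq_nonneg: "0 \<le> lim_freq A s"
proof (cases "convergent (\<lambda>k. emp_freq A (4 ^ k) s)")
  case True
  from lim_freq_tendsto[OF this] show ?thesis
    by (rule LIMSEQ_le_const) (auto intro: emp_freq_nonneg)
qed (simp add: lim_freq_def)

lemma lim_freq_le_1: "lim_freq A s \<le> 1"
proof (cases "convergent (\<lambda>k. emp_freq A (4 ^ k) s)")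
  case True
  from lim_freq_tendsto[OF this] show ?thesis
    by (rule LIMSEQ_le_const2) (auto intro: emp_freq_le_1)
qed (simp add: lim_freq_def)

text \<open>The measurability rules let the sequence \<open>s x\<close> depend on a point
  \<open>x\<close>, so that they apply both to the identity on sequence space and to
  \<open>\<lambda>i. Y i \<omega>\<close> on a probability space.\<close>

lemma measurable_emp_freq[measurable (raw)]:
  assumes [measurable]: "A \<in> sets S" "\<And>i. (\<lambda>x. s x i) \<in> measurable N S"
  shows "(\<lambda>x. emp_freq A n (s x)) \<in> borel_measurable N"
  unfolding emp_freq_def by measurable

lemma pred_convergent_emp_freq[measurable (raw)]:
  assumes [measurable]: "A \<in> sets S" "\<And>i. (\<lambda>x. s x i) \<in> measurable N S"
  shows "Measurable.pred N (\<lambda>x. convergent (\<lambda>k. emp_freq A (4 ^ k) (s x)))"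
  unfolding Cauchy_convergent_iff[symmetric] by measurable

lemma measurable_lim_freq[measurable (raw)]:
  assumes [measurable]: "A \<in> sets S" "\<And>i. (\<lambda>x. s x i) \<in> measurable N S"
  shows "(\<lambda>x. lim_freq A (s x)) \<in> borel_measurable N"
  unfolding lim_freq_def by measurable

section \<open>Frequencies under finite changes and shifts\<close>

lemma tendsto_bounded_divide_power4:
  fixes u v :: "nat \<Rightarrow> real"
  assumes "\<And>k. \<bar>u k - v k\<bar> \<le> c / 4 ^ k"
  shows "(\<lambda>k. u k - v k) \<longlonglongrightarrow> 0"
proof (rule Lim_null_comparison)
  show "\<forall>\<^sub>F k in sequentially. norm (u k - v k) \<le> c * (1 / 4) ^ k"
    using assms by (simp add: power_divide)
  show "(\<lambda>k. c * (1 / 4) ^ k) \<longlonglongrightarrow> 0"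
    by (intro tendsto_mult_right_zero LIMSEQ_realpow_zero) auto
qed

lemma emp_freq_finite_change:
  assumes fin: "finite {i. s i \<noteq> t i}"
  shows "(\<lambda>k. emp_freq A (4 ^ k) s - emp_freq A (4 ^ k) t) \<longlonglongrightarrow> 0"
proof (rule tendsto_bounded_divide_power4)
  fix k :: nat
  let ?D = "{i. s i \<noteq> t i}"
  have "\<bar>(\<Sum>i<4 ^ k. indicator A (s i)) - (\<Sum>i<4 ^ k. indicator A (t i))\<bar>
      = \<bar>\<Sum>i<4 ^ k. indicator A (s i) - indicator A (t i) :: real\<bar>"
    by (simp add: sum_subtractf)
  also have "\<dots> \<le> (\<Sum>i<4 ^ k. \<bar>indicator A (s i) - indicator A (t i) :: real\<bar>)"
    by (rule sum_abs)
  also have "\<dots> \<le> (\<Sum>i<4 ^ k. indicator ?D i)"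
    by (intro sum_mono) (auto simp: indicator_def)
  also have "\<dots> = real (card ({..<4 ^ k} \<inter> ?D))"
    by (simp add: sum.If_cases indicator_def)
  also have "\<dots> \<le> real (card ?D)"
    using fin by (simp add: card_mono)
  finally show "\<bar>emp_freq A (4 ^ k) s - emp_freq A (4 ^ k) t\<bar> \<le> real (card ?D) / 4 ^ k"
    by (simp add: emp_freq_def diff_divide_distrib[symmetric] divide_right_mono)
qed

text \<open>Both frequency sequences have the same limits, so the convergence test and the value
  agree, also where the default 0 is taken. The equality thus holds for every sequence, not just
  almost surely, as the pointwise symmetry hypothesis of
  \<open>integral_prod_indicator_eq_lim_freq\<close> demands.\<close>

lemma lim_freq_finite_change:
  assumes "finite {i. s i \<noteq> t i}"
  shows "lim_freq A s = lim_freq A t"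
proof -
  let ?u = "\<lambda>k. emp_freq A (4 ^ k) s" and ?v = "\<lambda>k. emp_freq A (4 ^ k) t"
  have *: "?u \<longlonglongrightarrow> l \<longleftrightarrow> ?v \<longlonglongrightarrow> l" for l
    using Lim_transform_eq[OF emp_freq_finite_change[OF assms, of A]] by simp
  then show ?thesis by (simp add: lim_freq_def convergent_def lim_def)
qed

lemma lim_freq_transpose: "lim_freq A (s \<circ> Transposition.transpose i j) = lim_freq A s"
  by (rule lim_freq_finite_change, rule finite_subset[of _ "{i, j}"])
     (auto simp: Transposition.transpose_def)

lemma emp_freq_shift_tendsto:
  assumes "convergent (\<lambda>k. emp_freq A (4 ^ k) s)"
  shows "(\<lambda>k. emp_freq A (4 ^ k) (\<lambda>i. s (r + i))) \<longlonglongrightarrow> lim_freq A s"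
proof -
  have "(\<lambda>k. emp_freq A (4 ^ k) (\<lambda>i. s (r + i)) - emp_freq A (4 ^ k) s) \<longlonglongrightarrow> 0"
  proof (rule tendsto_bounded_divide_power4)
    fix k :: nat
    let ?g = "\<lambda>i. indicator A (s i) :: real"
    have b: "0 \<le> (\<Sum>i\<in>I. ?g i)" "(\<Sum>i\<in>I. ?g i) \<le> real (card I)" for I
      using sum_mono[of I ?g "\<lambda>_. 1"] by (auto simp: sum_nonneg indicator_def)
    have "(\<Sum>i<4 ^ k. ?g (r + i)) = (\<Sum>i\<in>{r..<r + 4 ^ k}. ?g i)"
      using sum.shift_bounds_nat_ivl[of ?g 0 r "4 ^ k"] by (simp add: atLeast0LessThan add.commute)
    \<comment> \<open>The range below \<open>r + 4 ^ k\<close> is cut once at \<open>4 ^ k\<close>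
      and once at \<open>r\<close>. The two blocks thus differ by the difference of two sums that
      both lie between 0 and \<open>r\<close>.\<close>
    moreover have "(\<Sum>i<4 ^ k. ?g i) + (\<Sum>i\<in>{4 ^ k..<r + 4 ^ k}. ?g i)
        = (\<Sum>i<r. ?g i) + (\<Sum>i\<in>{r..<r + 4 ^ k}. ?g i)"
      using sum.atLeastLessThan_concat[of 0 "4 ^ k" "r + 4 ^ k" ?g]
        sum.atLeastLessThan_concat[of 0 r "r + 4 ^ k" ?g] by (simp add: atLeast0LessThan)
    ultimately have "\<bar>(\<Sum>i<4 ^ k. ?g (r + i)) - (\<Sum>i<4 ^ k. ?g i)\<bar> \<le> real r"
      using b[of "{4 ^ k..<r + 4 ^ k}"] b[of "{..<r}"] by auto
    then show "\<bar>emp_freq A (4 ^ k) (\<lambda>i. s (r + i)) - emp_freq A (4 ^ k) s\<bar> \<le> real r / 4 ^ k"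
      by (simp add: emp_freq_def diff_divide_distrib[symmetric] divide_right_mono)
  qed
  from tendsto_add[OF this lim_freq_tendsto[OF assms]] show ?thesis by simp
qed

section \<open>Exchangeable laws\<close>

lemma (in prob_space) integrable_bounded:
  fixes g :: "'a \<Rightarrow> real"
  assumes "g \<in> borel_measurable M" "\<And>x. \<bar>g x\<bar> \<le> c"
  shows "integrable M g"
  by (rule integrable_const_bound[where B=c]) (use assms in auto)

text \<open>Working with the law on sequence space allows reindexing functions of the whole
  sequence, such as \<open>lim_freq\<close>.\<close>

locale exchangeable_law = prob_space Q for Q :: "(nat \<Rightarrow> 's) measure" +
  fixes S :: "'s measure"
  assumes sets_Q: "sets Q = sets (PiM UNIV (\<lambda>_. S))"
    and invariant: "\<And>\<sigma>. inj \<sigma> \<Longrightarrow> distr Q (PiM UNIV (\<lambda>_. S)) (\<lambda>s. s \<circ> \<sigma>) = Q"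
begin

lemma measurable_coord[measurable]: "(\<lambda>s. s i) \<in> measurable Q S"
  by (subst measurable_cong_sets[OF sets_Q refl]) measurable

lemma measurable_reindex[measurable]: "(\<lambda>s. s \<circ> \<sigma>) \<in> measurable Q (PiM UNIV (\<lambda>_. S))"
  by (rule measurable_PiM_single')
     (auto simp: measurable_coord intro: measurable_space[OF measurable_coord])

lemma integral_reindex:
  fixes g :: "(nat \<Rightarrow> 's) \<Rightarrow> real"
  assumes "inj \<sigma>" and g: "g \<in> borel_measurable Q"
  shows "(\<integral>s. g (s \<circ> \<sigma>) \<partial>Q) = (\<integral>s. g s \<partial>Q)"
proof -
  have "g \<in> borel_measurable (PiM UNIV (\<lambda>_. S))"
    using g by (subst (asm) measurable_cong_sets[OF sets_Q refl])
  then have "(\<integral>s. g s \<partial>distr Q (PiM UNIV (\<lambda>_. S)) (\<lambda>s. s \<circ> \<sigma>)) = (\<integral>s. g (s \<circ> \<sigma>) \<partial>Q)"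
    by (rule integral_distr[OF measurable_reindex])
  then show ?thesis by (simp add: invariant assms)
qed

text \<open>By symmetry all \<open>?\<xi> i\<close> have one mean \<open>a\<close>, and all products
  of two different ones have one mean \<open>b\<close>. The covariance form is therefore
  \<open>a - b\<close> on the diagonal plus \<open>b\<close> everywhere.\<close>

lemma second_moment_linear:
  assumes A[measurable]: "A \<in> sets S"
  obtains a b where "0 \<le> b" "b \<le> a" "a \<le> 1"
    and "\<And>n (c :: nat \<Rightarrow> real). (\<integral>s. (\<Sum>i<n. c i * indicator A (s i))\<^sup>2 \<partial>Q)
           = (a - b) * (\<Sum>i<n. (c i)\<^sup>2) + b * (\<Sum>i<n. c i)\<^sup>2"
proof -
  let ?\<xi> = "\<lambda>i s. indicator A (s i) :: real"
  define a where "a = (\<integral>s. ?\<xi> 0 s \<partial>Q)"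
  define b where "b = (\<integral>s. ?\<xi> 0 s * ?\<xi> 1 s \<partial>Q)"
  have int: "integrable Q (\<lambda>s. ?\<xi> i s * ?\<xi> j s)" for i j
    by (rule integrable_bounded[where c=1]) (auto simp: indicator_def)
  have int1: "integrable Q (?\<xi> i)" for i
    by (rule integrable_bounded[where c=1]) (auto simp: indicator_def)
  have diag: "(\<integral>s. ?\<xi> i s * ?\<xi> i s \<partial>Q) = a" for i
  proof -
    have "(\<integral>s. ?\<xi> 0 (s \<circ> Transposition.transpose 0 i) \<partial>Q) = a"
      unfolding a_def by (rule integral_reindex) auto
    moreover have "?\<xi> i s * ?\<xi> i s = ?\<xi> i s" for s by (auto simp: indicator_def)
    ultimately show ?thesis by (simp only: comp_apply transpose_apply_first)
  qed
  have off: "(\<integral>s. ?\<xi> i s * ?\<xi> j s \<partial>Q) = b" if "i \<noteq> j" for i j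
  proof -
    \<comment> \<open>The inner transposition sends 1 to the index that the outer one carries to
      \<open>j\<close>. That index is not 0 because \<open>i \<noteq> j\<close>, so 0 still goes to
      \<open>i\<close>.\<close>
    let ?\<sigma> = "Transposition.transpose 0 i \<circ> Transposition.transpose 1 (Transposition.transpose 0 i j)"
    have "?\<sigma> 0 = i" "?\<sigma> 1 = j" using that by (auto simp: Transposition.transpose_def)
    moreover have "(\<integral>s. ?\<xi> 0 (s \<circ> ?\<sigma>) * ?\<xi> 1 (s \<circ> ?\<sigma>) \<partial>Q) = b"
      unfolding b_def by (rule integral_reindex[OF inj_compose]) auto
    ultimately show ?thesis by simp
  qed
  show thesis
  proof (rule that)
    show "0 \<le> b" unfolding b_def by (rule integral_nonneg_AE) auto
    show "b \<le> a" unfolding a_def b_def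
      by (rule integral_mono[OF int int1]) (auto simp: indicator_def)
    show "a \<le> 1"
      using integral_mono[OF int1[of 0] integrable_const[of "1::real"]]
      by (auto simp: a_def indicator_def prob_space)
    fix n :: nat and c :: "nat \<Rightarrow> real"
    have "(\<integral>s. (\<Sum>i<n. c i * ?\<xi> i s)\<^sup>2 \<partial>Q)
        = (\<integral>s. (\<Sum>i<n. \<Sum>j<n. c i * c j * (?\<xi> i s * ?\<xi> j s)) \<partial>Q)"
      by (simp only: power2_eq_square sum_product mult_ac)
    also have "\<dots> = (\<Sum>i<n. \<Sum>j<n. c i * c j * (\<integral>s. ?\<xi> i s * ?\<xi> j s \<partial>Q))"
      by (simp only: Bochner_Integration.integral_sum Bochner_Integration.integrable_sum
          integrable_mult_right int integral_mult_right_zero)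
    also have "\<dots> = (\<Sum>i<n. \<Sum>j<n. (if i = j then c i * c j * (a - b) else 0) + b * (c i * c j))"
      by (intro sum.cong refl) (auto simp: diag off algebra_simps)
    also have "\<dots> = (\<Sum>i<n. \<Sum>j<n. if i = j then c i * c j * (a - b) else 0)
        + (\<Sum>i<n. \<Sum>j<n. b * (c i * c j))"
      by (simp only: sum.distrib)
    also have "(\<Sum>i<n. \<Sum>j<n. if i = j then c i * c j * (a - b) else 0) = (a - b) * (\<Sum>i<n. (c i)\<^sup>2)"
      by (simp add: sum_distrib_right[symmetric] power2_eq_square)
    also have "(\<Sum>i<n. \<Sum>j<n. b * (c i * c j)) = b * (\<Sum>i<n. c i)\<^sup>2"
      unfolding power2_eq_square sum_product by (simp only: sum_distrib_left)
    finally show "(\<integral>s. (\<Sum>i<n. c i * ?\<xi> i s)\<^sup>2 \<partial>Q)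
        = (a - b) * (\<Sum>i<n. (c i)\<^sup>2) + b * (\<Sum>i<n. c i)\<^sup>2" .
  qed
qed

text \<open>The difference is a linear statistic whose weights sum to zero. The \<open>b\<close>
  term of the second moment then vanishes, leaving only the sum of squared weights, which is at most
  \<open>1 / m + 1 / n\<close>.\<close>

lemma emp_freq_L2_bound:
  assumes A[measurable]: "A \<in> sets S" and "0 < m" "m \<le> n"
  shows "(\<integral>s. (emp_freq A n s - emp_freq A m s)\<^sup>2 \<partial>Q) \<le> 2 / real m"
proof -
  obtain a b where ab: "0 \<le> b" "b \<le> a" "a \<le> 1"
    and *: "\<And>n (c :: nat \<Rightarrow> real). (\<integral>s. (\<Sum>i<n. c i * indicator A (s i))\<^sup>2 \<partial>Q)
           = (a - b) * (\<Sum>i<n. (c i)\<^sup>2) + b * (\<Sum>i<n. c i)\<^sup>2"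
    by (rule second_moment_linear[OF A]) (rule that)
  define c :: "nat \<Rightarrow> real" where "c i = 1 / real n - (if i < m then 1 / real m else 0)" for i
  have m: "{..<n} \<inter> {i. i < m} = {..<m}" using assms by auto
  have "emp_freq A n s - emp_freq A m s = (\<Sum>i<n. c i * indicator A (s i))" for s
  proof -
    have "(\<Sum>i<n. c i * indicator A (s i))
        = (\<Sum>i<n. indicator A (s i) / real n) - (\<Sum>i<n. if i < m then indicator A (s i) / real m else 0)"
      unfolding sum_subtractf[symmetric] by (intro sum.cong) (auto simp: c_def algebra_simps)
    then show ?thesis
      by (simp add: emp_freq_def sum_divide_distrib sum.If_cases m)
  qed
  moreover have "(\<Sum>i<n. c i) = 0"
    using assms by (simp add: c_def sum_subtractf sum.If_cases m)
  ultimately have "(\<integral>s. (emp_freq A n s - emp_freq A m s)\<^sup>2 \<partial>Q) = (a - b) * (\<Sum>i<n. (c i)\<^sup>2)"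
    by (simp only: *) simp
  also have "\<dots> \<le> 1 * (\<Sum>i<n. (c i)\<^sup>2)"
    using ab by (intro mult_right_mono sum_nonneg) auto
  also have "(\<Sum>i<n. (c i)\<^sup>2) \<le> (\<Sum>i<n. (if i < m then (1 / real m)\<^sup>2 else 0) + (1 / real n)\<^sup>2)"
  proof (intro sum_mono)
    fix i
    have "0 \<le> 1 / real n" "1 / real n \<le> 1 / real m" using assms by (auto simp: frac_le)
    then have "(1 / real n - 1 / real m)\<^sup>2 \<le> (1 / real m)\<^sup>2"
      by (intro power2_le_iff_abs_le[THEN iffD2]) auto
    then show "(c i)\<^sup>2 \<le> (if i < m then (1 / real m)\<^sup>2 else 0) + (1 / real n)\<^sup>2"
      using zero_le_power2[of "1 / real n"] by (cases "i < m") (simp_all add: c_def add_increasing2)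
  qed
  also have "\<dots> = 1 / real m + 1 / real n"
    using assms by (simp add: sum.distrib sum.If_cases m power2_eq_square)
  also have "\<dots> \<le> 2 / real m"
    using assms by (simp add: frac_le field_simps)
  finally show ?thesis by simp
qed

text \<open>The second moment of the \<open>k\<close>-th increment is of order
  \<open>4 ^ -k\<close>, hence its first absolute moment is of order \<open>2 ^ -k\<close>. These
  are summable, so the increments are almost surely absolutely summable and the frequencies converge
  by telescoping.\<close>

lemma AE_convergent_emp_freq:
  assumes A[measurable]: "A \<in> sets S"
  shows "AE s in Q. convergent (\<lambda>k. emp_freq A (4 ^ k) s)"
proof -
  let ?\<Delta> = "\<lambda>k s. emp_freq A (4 ^ Suc k) s - emp_freq A (4 ^ k) s"
  have mD[measurable]: "?\<Delta> k \<in> borel_measurable Q" for k by measurable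
  have b: "\<bar>?\<Delta> k s\<bar> \<le> 1" for k s
    using emp_freq_nonneg[of A _ s] emp_freq_le_1[of A _ s] by (smt (verit))
  have b2: "\<bar>(?\<Delta> k s)\<^sup>2\<bar> \<le> 1" for k s
    using b[of k s] by (simp add: abs_square_le_1)
  \<comment> \<open>The computation yields \<open>3 / 2\<close> in place of 2; the constant is
    rounded up.\<close>
  have bound: "(\<integral>\<^sup>+s. ennreal \<bar>?\<Delta> k s\<bar> \<partial>Q) \<le> ennreal (2 * (1 / 2) ^ k)" for k
  proof -
    have i2: "integrable Q (\<lambda>s. (?\<Delta> k s)\<^sup>2)"
      by (rule integrable_bounded[where c=1]) (use b2 in auto)
    \<comment> \<open>AM-GM with weight \<open>2 ^ k\<close> replaces the Cauchy-Schwarz inequality.\<close>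
    have amgm: "\<bar>x\<bar> \<le> 2 ^ k * x\<^sup>2 / 2 + (1 / 2) ^ k / 2" for x :: real
    proof -
      have "0 \<le> (2 ^ k * \<bar>x\<bar> - 1)\<^sup>2" by simp
      then have "2 * 2 ^ k * \<bar>x\<bar> \<le> (2 ^ k)\<^sup>2 * x\<^sup>2 + 1"
        by (simp add: power2_diff power_mult_distrib)
      then show ?thesis by (simp add: field_simps power2_eq_square)
    qed
    have "(\<integral>s. \<bar>?\<Delta> k s\<bar> \<partial>Q) \<le> (\<integral>s. 2 ^ k * (?\<Delta> k s)\<^sup>2 / 2 + (1 / 2) ^ k / 2 \<partial>Q)"
      by (intro integral_mono amgm) (use i2 b in \<open>auto intro!: integrable_bounded[where c=1]\<close>)
    also have "\<dots> = 2 ^ k * (\<integral>s. (?\<Delta> k s)\<^sup>2 \<partial>Q) / 2 + (1 / 2) ^ k / 2"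
      using i2 by (simp add: prob_space)
    also have "(\<integral>s. (?\<Delta> k s)\<^sup>2 \<partial>Q) \<le> 2 / real (4 ^ k)"
      by (rule emp_freq_L2_bound) auto
    also have "2 ^ k * (2 / real (4 ^ k)) / 2 + (1 / 2) ^ k / 2 \<le> 2 * (1 / 2 :: real) ^ k"
    proof -
      have "(4 :: real) ^ k = 2 ^ k * 2 ^ k" by (simp add: power_mult_distrib[symmetric])
      then show ?thesis by (simp add: power_divide field_simps)
    qed
    finally have "(\<integral>s. \<bar>?\<Delta> k s\<bar> \<partial>Q) \<le> 2 * (1 / 2) ^ k" by simp
    moreover have "(\<integral>\<^sup>+s. ennreal \<bar>?\<Delta> k s\<bar> \<partial>Q) = ennreal (\<integral>s. \<bar>?\<Delta> k s\<bar> \<partial>Q)"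
      by (rule nn_integral_eq_integral) (use b in \<open>auto intro!: integrable_bounded[where c=1]\<close>)
    ultimately show ?thesis by (simp add: ennreal_leI)
  qed
  have "(\<integral>\<^sup>+s. (\<Sum>k. ennreal \<bar>?\<Delta> k s\<bar>) \<partial>Q) = (\<Sum>k. \<integral>\<^sup>+s. ennreal \<bar>?\<Delta> k s\<bar> \<partial>Q)"
    by (rule nn_integral_suminf) measurable
  also have "\<dots> \<le> (\<Sum>k. ennreal (2 * (1 / 2) ^ k))"
    by (intro suminf_le bound) auto
  also have "\<dots> = ennreal (\<Sum>k. 2 * (1 / 2) ^ k)"
    by (rule suminf_ennreal2) (auto intro!: summable_mult summable_geometric)
  finally have "(\<integral>\<^sup>+s. (\<Sum>k. ennreal \<bar>?\<Delta> k s\<bar>) \<partial>Q) \<noteq> \<infinity>"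
    by (auto simp: top_unique)
  then have "AE s in Q. (\<Sum>k. ennreal \<bar>?\<Delta> k s\<bar>) \<noteq> \<infinity>"
    by (intro nn_integral_PInf_AE) auto
  then show ?thesis
  proof eventually_elim
    case (elim s)
    then have "summable (\<lambda>k. \<bar>?\<Delta> k s\<bar>)"
      by (intro summable_suminf_not_top) auto
    then have "convergent (\<lambda>K. \<Sum>k<K. ?\<Delta> k s)"
      unfolding summable_iff_convergent[symmetric] by (rule summable_rabs_cancel)
    moreover have "(\<Sum>k<K. ?\<Delta> k s) = emp_freq A (4 ^ K) s - emp_freq A (4 ^ 0) s" for K
      by (rule sum_lessThan_telescope)
    ultimately have "convergent (\<lambda>K. emp_freq A (4 ^ K) s - emp_freq A (4 ^ 0) s)"
      by simp
    from convergent_add[OF this convergent_const[of "emp_freq A (4 ^ 0) s"]] show ?case by simp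
  qed
qed

text \<open>
  The core of de Finetti's theorem. The coordinate \<open>s N\<close> may be replaced by any later one, hence
  by the average over a long block of later ones; the resulting limit is again symmetric and so
  can be absorbed into \<open>\<Phi>\<close> in the induction.
\<close>

lemma integral_prod_indicator_eq_lim_freq:
  assumes "\<And>i. i < N \<Longrightarrow> A i \<in> sets S"
    and "\<Phi> \<in> borel_measurable Q" and "\<And>s. \<bar>\<Phi> s\<bar> \<le> (c :: real)"
    and "\<And>s i j. \<Phi> (s \<circ> Transposition.transpose i j) = \<Phi> s"
  shows "(\<integral>s. (\<Prod>i<N. indicator (A i) (s i)) * \<Phi> s \<partial>Q) = (\<integral>s. (\<Prod>i<N. lim_freq (A i) s) * \<Phi> s \<partial>Q)"
  using assms
proof (induction N arbitrary: \<Phi>)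
  case (Suc N)
  note [measurable] = Suc.prems(1) Suc.prems(2)
  have [measurable]: "A N \<in> sets S" by measurable
  let ?G = "\<lambda>s. (\<Prod>i<N. indicator (A i) (s i)) * \<Phi> s"
  have G[measurable]: "?G \<in> borel_measurable Q" by measurable
  have prod_le: "\<bar>\<Prod>i<N. indicator (A i) (s i) :: real\<bar> \<le> 1" for s
    unfolding abs_prod by (intro prod_le_1) (auto simp: indicator_def)
  have mul_le: "\<bar>x * y\<bar> \<le> c" if "\<bar>x\<bar> \<le> 1" "\<bar>y\<bar> \<le> c" for x y :: real
    using mult_mono[OF that] by (simp add: abs_mult)
  have Gle: "\<bar>?G s\<bar> \<le> c" for s
    using mul_le prod_le Suc.prems(3) by blast
  have GA: "\<bar>?G s * y\<bar> \<le> c" if "\<bar>y\<bar> \<le> 1" for s y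
    using mul_le[OF that Gle[of s]] by (simp add: mult.commute)
  have eq: "(\<integral>s. ?G s * indicator (A N) (s (N + m)) \<partial>Q) = (\<integral>s. ?G s * indicator (A N) (s N) \<partial>Q)" for m
  proof -
    \<comment> \<open>This transposition fixes all coordinates below \<open>N\<close> and leaves
      \<open>\<Phi>\<close> unchanged, so only the last factor moves.\<close>
    let ?\<tau> = "Transposition.transpose N (N + m)"
    have "(\<integral>s. ?G (s \<circ> ?\<tau>) * indicator (A N) ((s \<circ> ?\<tau>) N) \<partial>Q) = (\<integral>s. ?G s * indicator (A N) (s N) \<partial>Q)"
      by (rule integral_reindex) auto
    moreover have "?G (s \<circ> ?\<tau>) = ?G s" for s
      by (simp add: Suc.prems(4) Transposition.transpose_def)
    ultimately show ?thesis by (simp only: comp_apply transpose_apply_first)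
  qed
  have int: "integrable Q (\<lambda>s. ?G s * indicator (A N) (s (N + m)))" for m
    by (intro integrable_bounded[where c=c] GA) auto
  have avg: "(\<integral>s. ?G s * emp_freq (A N) (4 ^ k) (\<lambda>i. s (N + i)) \<partial>Q)
      = (\<integral>s. ?G s * indicator (A N) (s N) \<partial>Q)" for k
  proof -
    have "(\<integral>s. ?G s * emp_freq (A N) (4 ^ k) (\<lambda>i. s (N + i)) \<partial>Q)
        = (\<integral>s. (\<Sum>m<4 ^ k. ?G s * indicator (A N) (s (N + m))) / 4 ^ k \<partial>Q)"
      by (simp add: emp_freq_def sum_distrib_left)
    also have "\<dots> = (\<Sum>m<4 ^ k. (\<integral>s. ?G s * indicator (A N) (s (N + m)) \<partial>Q)) / 4 ^ k"
      by (simp only: integral_divide_zero Bochner_Integration.integral_sum int)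
    finally show ?thesis by (simp add: eq)
  qed
  have "(\<lambda>k. \<integral>s. ?G s * emp_freq (A N) (4 ^ k) (\<lambda>i. s (N + i)) \<partial>Q)
      \<longlonglongrightarrow> (\<integral>s. ?G s * lim_freq (A N) s \<partial>Q)"
  proof (rule integral_dominated_convergence[where w="\<lambda>_. c"])
    show "AE s in Q. (\<lambda>k. ?G s * emp_freq (A N) (4 ^ k) (\<lambda>i. s (N + i))) \<longlonglongrightarrow> ?G s * lim_freq (A N) s"
      using AE_convergent_emp_freq[OF \<open>A N \<in> sets S\<close>]
      by eventually_elim (auto intro!: tendsto_mult_left emp_freq_shift_tendsto)
    show "AE s in Q. norm (?G s * emp_freq (A N) (4 ^ k) (\<lambda>i. s (N + i))) \<le> c" for k
      by (intro AE_I2) (simp only: real_norm_def, rule GA, simp add: emp_freq_nonneg emp_freq_le_1)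
  qed auto
  then have "(\<integral>s. ?G s * indicator (A N) (s N) \<partial>Q) = (\<integral>s. ?G s * lim_freq (A N) s \<partial>Q)"
    unfolding avg by (simp add: LIMSEQ_const_iff)
  also have "\<dots> = (\<integral>s. (\<Prod>i<N. indicator (A i) (s i)) * (lim_freq (A N) s * \<Phi> s) \<partial>Q)"
    by (simp add: mult_ac)
  also have "\<dots> = (\<integral>s. (\<Prod>i<N. lim_freq (A i) s) * (lim_freq (A N) s * \<Phi> s) \<partial>Q)"
  proof (rule Suc.IH)
    show "\<bar>lim_freq (A N) s * \<Phi> s\<bar> \<le> c" for s
      by (intro mul_le Suc.prems(3)) (simp add: lim_freq_nonneg lim_freq_le_1)
    show "lim_freq (A N) (s \<circ> Transposition.transpose i j) * \<Phi> (s \<circ> Transposition.transpose i j)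
        = lim_freq (A N) s * \<Phi> s" for s i j
      by (simp only: Suc.prems(4) lim_freq_transpose)
  qed (auto intro: Suc.prems(1))
  finally show ?case by (simp add: mult_ac)
qed simp

end

section \<open>Hidden Markov models\<close>

text \<open>Writing the sum over \<open>I\<close> as an integral over \<open>count_space\<close>
  keeps it in \<open>ennreal\<close>, where no summability has to be shown.\<close>

lemma emeasure_countable_partition:
  assumes I: "countable I" and V: "V \<in> measurable M (count_space I)" and E[measurable]: "E \<in> sets M"
  shows "emeasure M E = (\<integral>\<^sup>+v. emeasure M {\<omega> \<in> E. V \<omega> = v} \<partial>count_space I)"
proof -
  have *: "{\<omega> \<in> E. V \<omega> = v} = E \<inter> (V -` {v} \<inter> space M)" for v
    using sets.sets_into_space[OF E] by auto
  have "V -` {v} \<inter> space M \<in> sets M" if "v \<in> I" for v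
    using measurable_sets[OF V, of "{v}"] that by simp
  then have "emeasure M (\<Union>v\<in>I. {\<omega> \<in> E. V \<omega> = v}) = (\<integral>\<^sup>+v. emeasure M {\<omega> \<in> E. V \<omega> = v} \<partial>count_space I)"
    using I by (intro emeasure_UN_countable) (auto simp: * disjoint_family_on_def)
  moreover have "(\<Union>v\<in>I. {\<omega> \<in> E. V \<omega> = v}) = E"
    using measurable_space[OF V] sets.sets_into_space[OF E] by auto
  ultimately show ?thesis by simp
qed

text \<open>The kernel and the read-outs, existentially quantified in the definitions, become the
  parameters \<open>K\<close> and \<open>f\<close>.\<close>

locale hidden_markov = prob_space M for M :: "'v measure" +
  fixes S :: "'s measure" and XX :: "'x set" and X :: "nat \<Rightarrow> 'v \<Rightarrow> 'x" and Y :: "nat \<Rightarrow> 'v \<Rightarrow> 's"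
    and K :: "'x \<Rightarrow> 'x pmf" and f :: "'x \<Rightarrow> 's measure"
  assumes countable_XX: "countable XX"
    and measurable_X: "\<And>n. X n \<in> measurable M (count_space XX)"
    and measurable_Y[measurable]: "\<And>n. Y n \<in> measurable M S"
    and markov: "\<And>n x y. (\<And>i. i \<le> n \<Longrightarrow> x i \<in> XX) \<Longrightarrow> y \<in> XX \<Longrightarrow>
          \<P>(\<omega> in M. \<forall>i\<le>n. X i \<omega> = x i) > 0 \<Longrightarrow>
          \<P>(\<omega> in M. X (Suc n) \<omega> = y \<bar> \<forall>i\<le>n. X i \<omega> = x i) = pmf (K (x n)) y"
    and indep_obs: "\<And>N x B. (\<And>i. i \<le> N \<Longrightarrow> x i \<in> XX) \<Longrightarrow> (\<And>i. i \<le> N \<Longrightarrow> B i \<in> sets S) \<Longrightarrow>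
        \<P>(\<omega> in M. \<forall>i\<le>N. X i \<omega> = x i) > 0 \<Longrightarrow>
        \<P>(\<omega> in M. \<forall>i\<le>N. Y i \<omega> \<in> B i \<bar> \<forall>i\<le>N. X i \<omega> = x i) =
          (\<Prod>i\<le>N. \<P>(\<omega> in M. Y i \<omega> \<in> B i \<bar> X i \<omega> = x i))"
    and prob_readout: "\<And>x. x \<in> XX \<Longrightarrow> f x \<in> space (prob_algebra S)"
    and readout: "\<And>n x B. x \<in> XX \<Longrightarrow> B \<in> sets S \<Longrightarrow> \<P>(\<omega> in M. X n \<omega> = x) > 0 \<Longrightarrow>
          \<P>(\<omega> in M. Y n \<omega> \<in> B \<bar> X n \<omega> = x) = measure (f x) B"
begin

lemma measurable_X'[measurable]: "X n \<in> measurable M (count_space UNIV)"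
  using measurable_X by (rule measurable_compose) auto

lemma X_in: "\<omega> \<in> space M \<Longrightarrow> X n \<omega> \<in> XX"
  using measurable_space[OF measurable_X] by simp

lemma pred_obs:
  assumes "\<And>i. i < n \<Longrightarrow> B i \<in> sets S"
  shows "Measurable.pred M (\<lambda>\<omega>. \<forall>i<n. Y i \<omega> \<in> B i)"
proof -
  have "Measurable.pred M (\<lambda>\<omega>. Y i \<omega> \<in> B i)" if "i < n" for i
    using assms[OF that] by measurable
  then show ?thesis
    by (intro pred_intros_countable pred_intros_imp')
qed

section \<open>Joint law of states and observations\<close>

definition path_prob :: "nat \<Rightarrow> (nat \<Rightarrow> 'x) \<Rightarrow> real" where
  "path_prob n x = \<P>(\<omega> in M. \<forall>i\<le>n. X i \<omega> = x i)"

text \<open>No positivity is assumed: the conditional probability is constrained only on paths of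
  positive probability, but on a null path both sides vanish by monotonicity. The same case split
  serves in \<open>prob_path_obs\<close>.\<close>

lemma path_prob_Suc:
  assumes x: "\<And>i. i \<le> Suc n \<Longrightarrow> x i \<in> XX"
  shows "path_prob (Suc n) x = path_prob n x * pmf (K (x n)) (x (Suc n))"
proof (cases "path_prob n x > 0")
  case True
  have "{\<omega> \<in> space M. \<forall>i\<le>Suc n. X i \<omega> = x i} = {\<omega> \<in> space M. X (Suc n) \<omega> = x (Suc n) \<and> (\<forall>i\<le>n. X i \<omega> = x i)}"
    by (auto simp: le_Suc_eq)
  then show ?thesis
    using markov[of n x "x (Suc n)"] x True by (simp add: path_prob_def cond_prob_def field_simps)
next
  case False
  have "path_prob (Suc n) x \<le> path_prob n x"
    unfolding path_prob_def by (intro finite_measure_mono) auto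
  moreover have "path_prob n x = 0" "0 \<le> path_prob (Suc n) x"
    using False by (auto simp: path_prob_def not_less measure_le_0_iff)
  ultimately show ?thesis by simp
qed

lemma prob_path_obs:
  assumes x: "\<And>i. i \<le> n \<Longrightarrow> x i \<in> XX" and B: "\<And>i. i \<le> n \<Longrightarrow> B i \<in> sets S"
  shows "\<P>(\<omega> in M. (\<forall>i\<le>n. X i \<omega> = x i) \<and> (\<forall>i\<le>n. Y i \<omega> \<in> B i))
       = path_prob n x * (\<Prod>i\<le>n. measure (f (x i)) (B i))"
proof (cases "path_prob n x > 0")
  case True
  have "\<P>(\<omega> in M. Y i \<omega> \<in> B i \<bar> X i \<omega> = x i) = measure (f (x i)) (B i)" if "i \<le> n" for i
  proof (rule readout)
    have "path_prob n x \<le> \<P>(\<omega> in M. X i \<omega> = x i)"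
      unfolding path_prob_def by (intro finite_measure_mono) (use that in auto)
    with True show "\<P>(\<omega> in M. X i \<omega> = x i) > 0" by simp
  qed (use that x B in auto)
  then have "\<P>(\<omega> in M. \<forall>i\<le>n. Y i \<omega> \<in> B i \<bar> \<forall>i\<le>n. X i \<omega> = x i) = (\<Prod>i\<le>n. measure (f (x i)) (B i))"
    using indep_obs[of n x B] x B True by (simp add: path_prob_def)
  then show ?thesis
    using True by (simp add: cond_prob_def path_prob_def field_simps conj_commute)
next
  case False
  have "\<P>(\<omega> in M. (\<forall>i\<le>n. X i \<omega> = x i) \<and> (\<forall>i\<le>n. Y i \<omega> \<in> B i)) \<le> path_prob n x"
    unfolding path_prob_def by (intro finite_measure_mono) auto
  moreover have "path_prob n x = 0"
    using False by (auto simp: path_prob_def not_less measure_le_0_iff)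
  ultimately show ?thesis by (simp add: measure_le_0_iff)
qed

lemma measure_readout_space: "x \<in> XX \<Longrightarrow> measure (f x) (space S) = 1"
  using in_space_prob_algebra[OF prob_readout] by (simp add: measure_def)

text \<open>The weight \<open>q\<close> is the probability of an observation in \<open>A\<close>
  after \<open>j\<close> steps from a given state. Placing the quantifiers over \<open>n\<close>,
  \<open>x\<close> and \<open>B\<close> inside the existential expresses both the Markov property
  and homogeneity: \<open>q\<close> sees only the last state and not the time. This also makes the
  induction on \<open>j\<close> work, since one more step extends the path and raises
  \<open>n\<close>.\<close>

lemma ex_future_obs_weight:
  assumes A[measurable]: "A \<in> sets S"
  shows "\<exists>q. \<forall>n x B. (\<forall>i\<le>n. x i \<in> XX) \<longrightarrow> (\<forall>i<n. B i \<in> sets S) \<longrightarrow>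
     emeasure M {\<omega> \<in> space M. (\<forall>i\<le>n. X i \<omega> = x i) \<and> (\<forall>i<n. Y i \<omega> \<in> B i) \<and> Y (n + j) \<omega> \<in> A}
     = ennreal (path_prob n x * (\<Prod>i<n. measure (f (x i)) (B i))) * q (x n)"
proof (induction j)
  case 0
  show ?case
  proof (intro exI allI impI)
    fix n :: nat and x :: "nat \<Rightarrow> 'x" and B :: "nat \<Rightarrow> 's set"
    assume x: "\<forall>i\<le>n. x i \<in> XX" and B: "\<forall>i<n. B i \<in> sets S"
    let ?E = "{\<omega> \<in> space M. (\<forall>i\<le>n. X i \<omega> = x i) \<and> (\<forall>i<n. Y i \<omega> \<in> B i) \<and> Y (n + 0) \<omega> \<in> A}"
    have "?E = {\<omega> \<in> space M. (\<forall>i\<le>n. X i \<omega> = x i) \<and> (\<forall>i\<le>n. Y i \<omega> \<in> (B(n := A)) i)}"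
      by (auto simp: le_less)
    then have "measure M ?E = path_prob n x * (\<Prod>i\<le>n. measure (f (x i)) ((B(n := A)) i))"
      using prob_path_obs[of n x "B(n := A)"] x B by simp
    also have "\<dots> = path_prob n x * (\<Prod>i<n. measure (f (x i)) (B i)) * measure (f (x n)) A"
      by (simp add: lessThan_Suc_atMost[symmetric])
    finally show "emeasure M ?E = ennreal (path_prob n x * (\<Prod>i<n. measure (f (x i)) (B i))) * ennreal (measure (f (x n)) A)"
      by (simp add: emeasure_eq_measure ennreal_mult'')
  qed
next
  case (Suc j)
  then obtain q where q: "\<And>n x B. (\<forall>i\<le>n. x i \<in> XX) \<Longrightarrow> (\<forall>i<n. B i \<in> sets S) \<Longrightarrow>
     emeasure M {\<omega> \<in> space M. (\<forall>i\<le>n. X i \<omega> = x i) \<and> (\<forall>i<n. Y i \<omega> \<in> B i) \<and> Y (n + j) \<omega> \<in> A}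
     = ennreal (path_prob n x * (\<Prod>i<n. measure (f (x i)) (B i))) * q (x n)"
    by blast
  show ?case
  proof (intro exI allI impI)
    fix n :: nat and x :: "nat \<Rightarrow> 'x" and B :: "nat \<Rightarrow> 's set"
    assume x: "\<forall>i\<le>n. x i \<in> XX" and B: "\<forall>i<n. B i \<in> sets S"
    let ?E = "{\<omega> \<in> space M. (\<forall>i\<le>n. X i \<omega> = x i) \<and> (\<forall>i<n. Y i \<omega> \<in> B i) \<and> Y (n + Suc j) \<omega> \<in> A}"
    let ?c = "ennreal (path_prob n x * (\<Prod>i<n. measure (f (x i)) (B i)))"
    have "Measurable.pred M (\<lambda>\<omega>. \<forall>i\<le>n. X i \<omega> = x i)" "Measurable.pred M (\<lambda>\<omega>. Y (n + Suc j) \<omega> \<in> A)"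
      by measurable
    moreover have "Measurable.pred M (\<lambda>\<omega>. \<forall>i<n. Y i \<omega> \<in> B i)"
      using B by (intro pred_obs) auto
    ultimately have "?E \<in> sets M"
      unfolding pred_def[symmetric] by (intro pred_intros_logic)
    then have "emeasure M ?E = (\<integral>\<^sup>+y. emeasure M {\<omega> \<in> ?E. X (Suc n) \<omega> = y} \<partial>count_space XX)"
      by (rule emeasure_countable_partition[OF countable_XX measurable_X])
    also have "\<dots> = (\<integral>\<^sup>+y. ?c * (ennreal (pmf (K (x n)) y) * q y) \<partial>count_space XX)"
    proof (rule nn_integral_cong)
      fix y assume "y \<in> space (count_space XX)"
      then have y: "y \<in> XX" by simp
      \<comment> \<open>The observation at time \<open>n\<close> becomes part of the past but is
        unrestricted, so \<open>space S\<close> is inserted and contributes a factor 1.\<close>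
      let ?x = "x(Suc n := y)" and ?B = "B(n := space S)"
      have "{\<omega> \<in> ?E. X (Suc n) \<omega> = y} = {\<omega> \<in> space M. (\<forall>i\<le>Suc n. X i \<omega> = ?x i) \<and>
          (\<forall>i<Suc n. Y i \<omega> \<in> ?B i) \<and> Y (Suc n + j) \<omega> \<in> A}"
        using measurable_space[OF measurable_Y] by (auto simp: le_Suc_eq less_Suc_eq)
      then have "emeasure M {\<omega> \<in> ?E. X (Suc n) \<omega> = y}
          = ennreal (path_prob (Suc n) ?x * (\<Prod>i<Suc n. measure (f (?x i)) (?B i))) * q (?x (Suc n))"
        using q[of "Suc n" ?x ?B] x y B by (simp add: le_Suc_eq less_Suc_eq)
      also have "path_prob (Suc n) ?x = path_prob n ?x * pmf (K (x n)) y"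
        using x y by (subst path_prob_Suc) auto
      also have "path_prob n ?x = path_prob n x"
        unfolding path_prob_def by (intro arg_cong[where f="measure M"]) auto
      also have "(\<Prod>i<Suc n. measure (f (?x i)) (?B i)) = (\<Prod>i<n. measure (f (x i)) (B i))"
        using x by (simp add: measure_readout_space)
      finally show "emeasure M {\<omega> \<in> ?E. X (Suc n) \<omega> = y} = ?c * (ennreal (pmf (K (x n)) y) * q y)"
        by (simp add: ennreal_mult''[symmetric] mult.assoc[symmetric]) (simp add: mult_ac)
    qed
    also have "\<dots> = ?c * (\<integral>\<^sup>+y. ennreal (pmf (K (x n)) y) * q y \<partial>count_space XX)"
      by (rule nn_integral_cmult) simp
    \<comment> \<open>This fixes the witness left open by \<open>exI\<close>: one step of the kernel
      followed by the old weight.\<close>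
    finally show "emeasure M ?E = ?c * (\<integral>\<^sup>+y. ennreal (pmf (K (x n)) y) * q y \<partial>count_space XX)" .
  qed
qed

section \<open>Past events that end in a given state\<close>

lemma measurable_path: "(\<lambda>\<omega>. \<lambda>i\<in>{..n}. X i \<omega>) \<in> measurable M (count_space ({..n} \<rightarrow>\<^sub>E XX))"
proof (subst measurable_count_space_eq_countable)
  show "countable ({..n} \<rightarrow>\<^sub>E XX)"
    by (intro countable_PiE countable_XX) auto
  have "(\<lambda>\<omega>. \<lambda>i\<in>{..n}. X i \<omega>) -` {v} \<inter> space M \<in> sets M" if "v \<in> {..n} \<rightarrow>\<^sub>E XX" for v
  proof -
    have "(\<lambda>\<omega>. \<lambda>i\<in>{..n}. X i \<omega>) -` {v} \<inter> space M = {\<omega> \<in> space M. \<forall>i\<le>n. X i \<omega> = v i}"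
      using that by (auto simp: fun_eq_iff PiE_iff extensional_def restrict_def)
    also have "\<dots> \<in> sets M" by measurable
    finally show ?thesis .
  qed
  then show "(\<lambda>\<omega>. \<lambda>i\<in>{..n}. X i \<omega>) \<in> space M \<rightarrow> {..n} \<rightarrow>\<^sub>E XX \<and>
      (\<forall>v\<in>{..n} \<rightarrow>\<^sub>E XX. (\<lambda>\<omega>. \<lambda>i\<in>{..n}. X i \<omega>) -` {v} \<inter> space M \<in> sets M)"
    by (auto simp: X_in)
qed

text \<open>\<open>R\<close> may be any predicate because a finite path takes only countably many
  values. It will express that \<open>n\<close> is the first visit to \<open>x\<close> after a given
  time. The observation at time \<open>n\<close> itself is left free, since the future starts
  there.\<close>

definition past_event :: "((nat \<Rightarrow> 'x) \<Rightarrow> bool) \<Rightarrow> (nat \<Rightarrow> 's set) \<Rightarrow> nat \<Rightarrow> 'x \<Rightarrow> 'v set" where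
  "past_event R B n x =
     {\<omega> \<in> space M. R (\<lambda>i\<in>{..n}. X i \<omega>) \<and> X n \<omega> = x \<and> (\<forall>i<n. Y i \<omega> \<in> B i)}"

lemma sets_past_event:
  assumes "\<And>i. i < n \<Longrightarrow> B i \<in> sets S"
  shows "past_event R B n x \<in> sets M"
proof -
  have "Measurable.pred M (\<lambda>\<omega>. \<forall>i<n. Y i \<omega> \<in> B i)"
    using assms by (rule pred_obs)
  moreover have "Measurable.pred M (\<lambda>\<omega>. R (\<lambda>i\<in>{..n}. X i \<omega>))"
    by (rule measurable_compose[OF measurable_path]) simp
  moreover have "Measurable.pred M (\<lambda>\<omega>. X n \<omega> = x)" by measurable
  ultimately show ?thesis
    unfolding past_event_def pred_def[symmetric] by (intro pred_intros_logic)
qed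

text \<open>The event splits into countably many paths, all ending in \<open>x\<close>. Each
  contributes the same factor \<open>q x\<close>, which can be pulled out of the sum.\<close>

lemma ex_future_weight_past_event:
  assumes A[measurable]: "A \<in> sets S"
  shows "\<exists>q. \<forall>R n x B. (\<forall>i<n. B i \<in> sets S) \<longrightarrow>
     emeasure M {\<omega> \<in> past_event R B n x. Y (n + j) \<omega> \<in> A} = emeasure M (past_event R B n x) * q x"
proof -
  obtain q where q: "\<And>n x B. (\<forall>i\<le>n. x i \<in> XX) \<Longrightarrow> (\<forall>i<n. B i \<in> sets S) \<Longrightarrow>
     emeasure M {\<omega> \<in> space M. (\<forall>i\<le>n. X i \<omega> = x i) \<and> (\<forall>i<n. Y i \<omega> \<in> B i) \<and> Y (n + j) \<omega> \<in> A}
     = ennreal (path_prob n x * (\<Prod>i<n. measure (f (x i)) (B i))) * q (x n)"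
    using ex_future_obs_weight[OF A] by blast
  \<comment> \<open>With the observation at time \<open>n\<close> left free through
    \<open>space S\<close>, the path formula gives the same prefactor without the weight.\<close>
  have obs: "emeasure M {\<omega> \<in> space M. (\<forall>i\<le>n. X i \<omega> = x i) \<and> (\<forall>i<n. Y i \<omega> \<in> B i)}
     = ennreal (path_prob n x * (\<Prod>i<n. measure (f (x i)) (B i)))"
    if x: "\<forall>i\<le>n. x i \<in> XX" and B: "\<forall>i<n. B i \<in> sets S" for n x B
  proof -
    have "{\<omega> \<in> space M. (\<forall>i\<le>n. X i \<omega> = x i) \<and> (\<forall>i<n. Y i \<omega> \<in> B i)}
        = {\<omega> \<in> space M. (\<forall>i\<le>n. X i \<omega> = x i) \<and> (\<forall>i\<le>n. Y i \<omega> \<in> (B(n := space S)) i)}"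
      using measurable_space[OF measurable_Y] by (auto simp: le_less)
    then show ?thesis
      using prob_path_obs[of n x "B(n := space S)"] x B
      by (simp add: emeasure_eq_measure lessThan_Suc_atMost[symmetric] measure_readout_space)
  qed
  show ?thesis
  proof (intro exI allI impI)
    fix R and n :: nat and x and B :: "nat \<Rightarrow> 's set"
    assume B: "\<forall>i<n. B i \<in> sets S"
    let ?D = "past_event R B n x" and ?V = "\<lambda>\<omega>. \<lambda>i\<in>{..n}. X i \<omega>" and ?I = "{..n} \<rightarrow>\<^sub>E XX"
    have D[measurable]: "?D \<in> sets M" using B by (intro sets_past_event) auto
    have cI: "countable ?I" by (intro countable_PiE countable_XX) auto
    have V: "?V \<omega> = v \<longleftrightarrow> (\<forall>i\<le>n. X i \<omega> = v i)" if "v \<in> ?I" for v \<omega>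
      using that by (auto simp: fun_eq_iff PiE_iff extensional_def restrict_def)
    have "emeasure M {\<omega> \<in> ?D. Y (n + j) \<omega> \<in> A}
        = (\<integral>\<^sup>+v. emeasure M {\<omega> \<in> {\<omega> \<in> ?D. Y (n + j) \<omega> \<in> A}. ?V \<omega> = v} \<partial>count_space ?I)"
      by (rule emeasure_countable_partition[OF cI measurable_path]) measurable
    also have "\<dots> = (\<integral>\<^sup>+v. emeasure M {\<omega> \<in> ?D. ?V \<omega> = v} * q x \<partial>count_space ?I)"
    proof (rule nn_integral_cong)
      fix v assume "v \<in> space (count_space ?I)"
      then have v: "v \<in> ?I" by simp
      then have vX: "\<forall>i\<le>n. v i \<in> XX" by auto
      show "emeasure M {\<omega> \<in> {\<omega> \<in> ?D. Y (n + j) \<omega> \<in> A}. ?V \<omega> = v} = emeasure M {\<omega> \<in> ?D. ?V \<omega> = v} * q x"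
      proof (cases "R v \<and> v n = x")
        case True
        have Vn: "?V \<omega> = v \<Longrightarrow> X n \<omega> = v n" for \<omega>
          using V[OF v] by auto
        have "{\<omega> \<in> {\<omega> \<in> ?D. Y (n + j) \<omega> \<in> A}. ?V \<omega> = v}
            = {\<omega> \<in> space M. (\<forall>i\<le>n. X i \<omega> = v i) \<and> (\<forall>i<n. Y i \<omega> \<in> B i) \<and> Y (n + j) \<omega> \<in> A}"
          using True Vn by (auto simp: past_event_def V[OF v, symmetric])
        moreover have "{\<omega> \<in> ?D. ?V \<omega> = v}
            = {\<omega> \<in> space M. (\<forall>i\<le>n. X i \<omega> = v i) \<and> (\<forall>i<n. Y i \<omega> \<in> B i)}"
          using True Vn by (auto simp: past_event_def V[OF v, symmetric])
        ultimately show ?thesis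
          using True q[OF vX B] obs[OF vX B] by simp
      next
        case False
        then have "{\<omega> \<in> ?D. ?V \<omega> = v} = {}"
          by (auto simp: past_event_def)
        then have "{\<omega> \<in> {\<omega> \<in> ?D. Y (n + j) \<omega> \<in> A}. ?V \<omega> = v} = {}" by blast
        then show ?thesis using \<open>{\<omega> \<in> ?D. ?V \<omega> = v} = {}\<close> by (simp only: emeasure_empty mult_zero_left)
      qed
    qed
    also have "\<dots> = (\<integral>\<^sup>+v. emeasure M {\<omega> \<in> ?D. ?V \<omega> = v} \<partial>count_space ?I) * q x"
      by (rule nn_integral_multc) simp
    also have "(\<integral>\<^sup>+v. emeasure M {\<omega> \<in> ?D. ?V \<omega> = v} \<partial>count_space ?I) = emeasure M ?D"
      by (rule emeasure_countable_partition[OF cI measurable_path, symmetric]) measurable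
    finally show "emeasure M {\<omega> \<in> ?D. Y (n + j) \<omega> \<in> A} = emeasure M ?D * q x" .
  qed
qed

text \<open>Given any past ending in \<open>x\<close> at time \<open>n\<close>, the observation
  \<open>j\<close> steps later is distributed as it is \<open>j\<close> steps after
  \<open>X m = x\<close>. The unknown weight is eliminated by also applying the preceding lemma to
  the event \<open>X m = x\<close>; the product form covers null events.\<close>

lemma future_indep_past_event:
  assumes A: "A \<in> sets S" and B: "\<And>i. i < n \<Longrightarrow> B i \<in> sets S"
  shows "\<P>(\<omega> in M. X m \<omega> = x) * prob {\<omega> \<in> past_event R B n x. Y (n + j) \<omega> \<in> A}
       = prob (past_event R B n x) * \<P>(\<omega> in M. X m \<omega> = x \<and> Y (m + j) \<omega> \<in> A)"
proof -
  obtain q where "\<forall>R n x B. (\<forall>i<n. B i \<in> sets S) \<longrightarrow>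
     emeasure M {\<omega> \<in> past_event R B n x. Y (n + j) \<omega> \<in> A} = emeasure M (past_event R B n x) * q x"
    using ex_future_weight_past_event[OF A] by (rule exE)
  note q = this[rule_format]
  have *: "past_event (\<lambda>_. True) (\<lambda>_. space S) m x = {\<omega> \<in> space M. X m \<omega> = x}"
    using measurable_space[OF measurable_Y] by (auto simp: past_event_def)
  have 1: "emeasure M {\<omega> \<in> space M. X m \<omega> = x \<and> Y (m + j) \<omega> \<in> A}
      = emeasure M {\<omega> \<in> space M. X m \<omega> = x} * q x"
    using q[of m "\<lambda>_. space S" "\<lambda>_. True" x] by (simp add: * conj_assoc)
  have 2: "emeasure M {\<omega> \<in> past_event R B n x. Y (n + j) \<omega> \<in> A} = emeasure M (past_event R B n x) * q x"
    using B by (intro q)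
  have "emeasure M {\<omega> \<in> space M. X m \<omega> = x} * emeasure M {\<omega> \<in> past_event R B n x. Y (n + j) \<omega> \<in> A}
      = emeasure M (past_event R B n x) * emeasure M {\<omega> \<in> space M. X m \<omega> = x \<and> Y (m + j) \<omega> \<in> A}"
    unfolding 1 2 by (simp only: mult_ac)
  then show ?thesis
    by (simp add: emeasure_eq_measure ennreal_mult[symmetric])
qed

section \<open>Limiting frequencies given a visit to a state\<close>

lemma integral_emp_freq_shift_tendsto:
  assumes A[measurable]: "A \<in> sets S"
    and conv: "AE \<omega> in M. convergent (\<lambda>k. emp_freq A (4 ^ k) (\<lambda>i. Y i \<omega>))"
    and g[measurable]: "g \<in> borel_measurable M" and g1: "\<And>\<omega>. \<bar>g \<omega>\<bar> \<le> (1 :: real)"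
  shows "(\<lambda>k. \<integral>\<omega>. g \<omega> * emp_freq A (4 ^ k) (\<lambda>i. Y (r + i) \<omega>) \<partial>M)
           \<longlonglongrightarrow> (\<integral>\<omega>. g \<omega> * lim_freq A (\<lambda>i. Y i \<omega>) \<partial>M)"
proof (rule integral_dominated_convergence[where w="\<lambda>_. 1"])
  show "AE \<omega> in M. (\<lambda>k. g \<omega> * emp_freq A (4 ^ k) (\<lambda>i. Y (r + i) \<omega>)) \<longlonglongrightarrow> g \<omega> * lim_freq A (\<lambda>i. Y i \<omega>)"
    using conv by eventually_elim (auto intro!: tendsto_mult_left emp_freq_shift_tendsto)
  show "AE \<omega> in M. norm (g \<omega> * emp_freq A (4 ^ k) (\<lambda>i. Y (r + i) \<omega>)) \<le> 1" for k
    using g1 by (auto simp: abs_mult emp_freq_nonneg emp_freq_le_1 intro!: mult_le_one)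
qed auto

text \<open>The factor \<open>g\<close> serves two uses: 1, which turns the summands into
  probabilities, and the limiting frequency itself.\<close>

lemma integral_indicator_emp_freq:
  assumes A[measurable]: "A \<in> sets S" and D[measurable]: "D \<in> sets M" and g[measurable]: "g \<in> borel_measurable M"
    and g1: "\<And>\<omega>. \<bar>g \<omega>\<bar> \<le> (1 :: real)"
  shows "(\<integral>\<omega>. indicator D \<omega> * g \<omega> * emp_freq A n (\<lambda>i. Y (r + i) \<omega>) \<partial>M)
       = (\<Sum>i<n. \<integral>\<omega>. indicator {\<omega> \<in> D. Y (r + i) \<omega> \<in> A} \<omega> * g \<omega> \<partial>M) / real n"
proof -
  have D': "{\<omega> \<in> D. Y (r + i) \<omega> \<in> A} \<in> sets M" for i
  proof -
    have "{\<omega> \<in> D. Y (r + i) \<omega> \<in> A} = D \<inter> {\<omega> \<in> space M. Y (r + i) \<omega> \<in> A}"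
      using sets.sets_into_space[OF D] by auto
    then show ?thesis by simp
  qed
  have int: "integrable M (\<lambda>\<omega>. indicator {\<omega> \<in> D. Y (r + i) \<omega> \<in> A} \<omega> * g \<omega>)" for i
    using g1 D' by (intro integrable_bounded[where c=1]) (auto simp: indicator_def)
  have "indicator D \<omega> * g \<omega> * emp_freq A n (\<lambda>i. Y (r + i) \<omega>)
      = (\<Sum>i<n. indicator {\<omega> \<in> D. Y (r + i) \<omega> \<in> A} \<omega> * g \<omega>) / real n" for \<omega>
  proof -
    have "(\<Sum>i<n. indicator {\<omega> \<in> D. Y (r + i) \<omega> \<in> A} \<omega> * g \<omega>)
        = (\<Sum>i<n. indicator D \<omega> * g \<omega> * indicator A (Y (r + i) \<omega>))"
      by (intro sum.cong) (auto simp: indicator_def)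
    then show ?thesis
      by (simp only: emp_freq_def sum_distrib_left times_divide_eq_right)
  qed
  then show ?thesis
    by (simp only: integral_divide_zero Bochner_Integration.integral_sum int)
qed

text \<open>The limiting frequency can be computed from the observations after time \<open>n\<close>
  as well as from those after time \<open>m\<close>. \<open>future_indep_past_event\<close> compares
  these term by term, and the averages pass to the limit.\<close>

lemma lim_freq_indep_past_event:
  assumes A[measurable]: "A \<in> sets S" and B: "\<And>i. i < n \<Longrightarrow> B i \<in> sets S"
    and conv: "AE \<omega> in M. convergent (\<lambda>k. emp_freq A (4 ^ k) (\<lambda>i. Y i \<omega>))"
  shows "\<P>(\<omega> in M. X m \<omega> = x) * (\<integral>\<omega>. indicator (past_event R B n x) \<omega> * lim_freq A (\<lambda>i. Y i \<omega>) \<partial>M)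
       = prob (past_event R B n x) * (\<integral>\<omega>. indicator {\<omega> \<in> space M. X m \<omega> = x} \<omega> * lim_freq A (\<lambda>i. Y i \<omega>) \<partial>M)"
proof -
  let ?p = "\<P>(\<omega> in M. X m \<omega> = x)" and ?D = "past_event R B n x" and ?G = "{\<omega> \<in> space M. X m \<omega> = x}"
  have D[measurable]: "?D \<in> sets M" using B by (rule sets_past_event)
  have G[measurable]: "?G \<in> sets M" by measurable
  have e: "(\<integral>\<omega>. indicator E \<omega> * emp_freq A k (\<lambda>i. Y (r + i) \<omega>) \<partial>M)
      = (\<Sum>i<k. prob {\<omega> \<in> E. Y (r + i) \<omega> \<in> A}) / real k" if "E \<in> sets M" for E r k
  proof -
    have "{\<omega> \<in> E. Y (r + i) \<omega> \<in> A} = E \<inter> {\<omega> \<in> space M. Y (r + i) \<omega> \<in> A}" for i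
      using sets.sets_into_space[OF that] by auto
    then have "{\<omega> \<in> E. Y (r + i) \<omega> \<in> A} \<in> sets M" for i using that by simp
    then show ?thesis
      using integral_indicator_emp_freq[OF A that, of "\<lambda>_. 1" k r] by simp
  qed
  have eq: "?p * (\<integral>\<omega>. indicator ?D \<omega> * emp_freq A (4 ^ k) (\<lambda>i. Y (n + i) \<omega>) \<partial>M)
      = prob ?D * (\<integral>\<omega>. indicator ?G \<omega> * emp_freq A (4 ^ k) (\<lambda>i. Y (m + i) \<omega>) \<partial>M)" for k
    unfolding e[OF D] e[OF G]
    by (simp add: sum_distrib_left future_indep_past_event[OF A B] conj_assoc)
  have "(\<lambda>k. ?p * (\<integral>\<omega>. indicator ?D \<omega> * emp_freq A (4 ^ k) (\<lambda>i. Y (n + i) \<omega>) \<partial>M))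
      \<longlonglongrightarrow> ?p * (\<integral>\<omega>. indicator ?D \<omega> * lim_freq A (\<lambda>i. Y i \<omega>) \<partial>M)"
    by (intro tendsto_mult_left integral_emp_freq_shift_tendsto[OF A conv]) (auto simp: indicator_def)
  moreover have "(\<lambda>k. ?p * (\<integral>\<omega>. indicator ?D \<omega> * emp_freq A (4 ^ k) (\<lambda>i. Y (n + i) \<omega>) \<partial>M))
      \<longlonglongrightarrow> prob ?D * (\<integral>\<omega>. indicator ?G \<omega> * lim_freq A (\<lambda>i. Y i \<omega>) \<partial>M)"
    unfolding eq
    by (intro tendsto_mult_left integral_emp_freq_shift_tendsto[OF A conv]) (auto simp: indicator_def)
  ultimately show ?thesis by (rule LIMSEQ_unique)
qed

text \<open>Decompose according to the first return to \<open>x\<close> after time \<open>i\<close>.\<close>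

lemma lim_freq_indep_obs:
  assumes A[measurable]: "A \<in> sets S"
    and conv: "AE \<omega> in M. convergent (\<lambda>k. emp_freq A (4 ^ k) (\<lambda>i. Y i \<omega>))"
    and rec: "AE \<omega> in M. X 1 \<omega> = x \<longrightarrow> infinite {n. X n \<omega> = x}"
  shows "\<P>(\<omega> in M. X 1 \<omega> = x) *
      (\<integral>\<omega>. indicator {\<omega> \<in> space M. X 1 \<omega> = x \<and> Y i \<omega> \<in> A} \<omega> * lim_freq A (\<lambda>i. Y i \<omega>) \<partial>M)
    = \<P>(\<omega> in M. X 1 \<omega> = x \<and> Y i \<omega> \<in> A) *
      (\<integral>\<omega>. indicator {\<omega> \<in> space M. X 1 \<omega> = x} \<omega> * lim_freq A (\<lambda>i. Y i \<omega>) \<partial>M)"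
    (is "?p * (\<integral>\<omega>. indicator ?E \<omega> * ?L \<omega> \<partial>M) = _ * ?c")
proof -
  \<comment> \<open>The clause \<open>v 1 = x\<close> makes the conditioning on \<open>X 1\<close>
    part of the past. The strict \<open>i < n\<close> puts time \<open>i\<close> among the
    constrained observations, which stop before \<open>n\<close>, and forces
    \<open>n \<ge> 1\<close>, so that the path up to \<open>n\<close> contains time 1.\<close>
  define R where "R n v \<longleftrightarrow> i < n \<and> v 1 = x \<and> (\<forall>l. i < l \<and> l < n \<longrightarrow> v l \<noteq> x)" for n and v :: "nat \<Rightarrow> 'x"
  define B where "B = (\<lambda>_. space S)(i := A)"
  define D where "D n = past_event (R n) B n x" for n
  have B: "B l \<in> sets S" for l by (simp add: B_def)
  have D_eq: "D n = {\<omega> \<in> space M. i < n \<and> X 1 \<omega> = x \<and> X n \<omega> = x \<and> Y i \<omega> \<in> A \<and>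
      (\<forall>l. i < l \<and> l < n \<longrightarrow> X l \<omega> \<noteq> x)}" for n
    using measurable_space[OF measurable_Y]
    by (auto simp: D_def past_event_def R_def B_def split: if_splits)
  have Dm[measurable]: "D n \<in> sets M" for n
    unfolding D_def using B by (rule sets_past_event)
  have disj: "D m \<inter> D n = {}" if "m \<noteq> n" for m n
    using that by (cases m n rule: linorder_cases) (auto simp: D_eq)
  have E[measurable]: "?E \<in> sets M" by measurable
  \<comment> \<open>Recurrence enters here: almost every point of \<open>?E\<close> has a first
    visit to \<open>x\<close> after time \<open>i\<close>.\<close>
  have U: "AE \<omega> in M. \<omega> \<in> (\<Union>n. D n) \<longleftrightarrow> \<omega> \<in> ?E"
    using rec AE_space
  proof eventually_elim
    case (elim \<omega>)
    show ?case
    proof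
      assume "\<omega> \<in> ?E"
      with elim have w: "\<omega> \<in> space M" "X 1 \<omega> = x" "Y i \<omega> \<in> A" "infinite {n. X n \<omega> = x}" by auto
      from w(4) have "\<exists>n. i < n \<and> X n \<omega> = x"
        by (auto simp: infinite_nat_iff_unbounded)
      then have "(LEAST n. i < n \<and> X n \<omega> = x) = n \<Longrightarrow> \<omega> \<in> D n" for n
        using w LeastI_ex[of "\<lambda>n. i < n \<and> X n \<omega> = x"] not_less_Least[of _ "\<lambda>n. i < n \<and> X n \<omega> = x"]
        by (auto simp: D_eq)
      then show "\<omega> \<in> (\<Union>n. D n)" by blast
    qed (auto simp: D_eq)
  qed
  have Lb: "\<bar>?L \<omega>\<bar> \<le> 1" for \<omega> by (simp add: lim_freq_nonneg lim_freq_le_1)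
  have "?p * (\<integral>\<omega>. indicator ?E \<omega> * ?L \<omega> \<partial>M) = ?p * (\<integral>\<omega>. indicator (\<Union>n. D n) \<omega> * ?L \<omega> \<partial>M)"
  proof (intro arg_cong[where f="(*) ?p"] integral_cong_AE)
    show "AE \<omega> in M. indicator ?E \<omega> * ?L \<omega> = indicator (\<Union>n. D n) \<omega> * ?L \<omega>"
      using U by eventually_elim (simp add: indicator_def)
  qed auto
  also have "(\<integral>\<omega>. indicator (\<Union>n. D n) \<omega> * ?L \<omega> \<partial>M) = (\<Sum>n. \<integral>\<omega>. indicator (D n) \<omega> * ?L \<omega> \<partial>M)"
  proof -
    have "set_integrable M (\<Union>n. D n) ?L"
      unfolding set_integrable_def using Lb
      by (intro integrable_bounded[where c=1]) (auto simp: indicator_def)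
    from lebesgue_integral_countable_add[OF Dm disj this] show ?thesis
      by (simp add: set_lebesgue_integral_def)
  qed
  also have "?p * \<dots> = (\<Sum>n. ?p * (\<integral>\<omega>. indicator (D n) \<omega> * ?L \<omega> \<partial>M))"
  proof (rule suminf_mult[symmetric], rule summable_comparison_test')
    have "disjoint_family D" using disj by (auto simp: disjoint_family_on_def)
    then show "summable (\<lambda>n. prob (D n))"
      by (intro sums_summable[OF finite_measure_UNION]) auto
    show "norm (\<integral>\<omega>. indicator (D n) \<omega> * ?L \<omega> \<partial>M) \<le> prob (D n)" if "n \<ge> 0" for n
    proof -
      have "(\<integral>\<omega>. indicator (D n) \<omega> * ?L \<omega> \<partial>M) \<le> (\<integral>\<omega>. indicator (D n) \<omega> \<partial>M)"
        using Lb by (intro integral_mono integrable_bounded[where c=1])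
          (auto simp: indicator_def lim_freq_le_1)
      moreover have "0 \<le> (\<integral>\<omega>. indicator (D n) \<omega> * ?L \<omega> \<partial>M)"
        by (intro integral_nonneg_AE) (auto simp: lim_freq_nonneg)
      ultimately show ?thesis by simp
    qed
  qed
  \<comment> \<open>The decoupling is used with \<open>m = 1\<close>, so that every term carries the
    same constant \<open>?c\<close>.\<close>
  also have "\<dots> = (\<Sum>n. prob (D n) * ?c)"
    unfolding D_def using lim_freq_indep_past_event[OF A B conv] by simp
  also have "\<dots> = prob (\<Union>n. D n) * ?c"
  proof -
    have "disjoint_family D" using disj by (auto simp: disjoint_family_on_def)
    then have "(\<lambda>n. prob (D n)) sums prob (\<Union>n. D n)"
      by (intro finite_measure_UNION) auto
    from sums_mult2[OF this, of ?c] show ?thesis by (simp add: sums_iff)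
  qed
  also have "prob (\<Union>n. D n) = prob ?E"
    using U by (intro finite_measure_eq_AE) auto
  finally show ?thesis .
qed

lemma AE_lim_freq_eq:
  assumes A[measurable]: "A \<in> sets S"
    and conv: "AE \<omega> in M. convergent (\<lambda>k. emp_freq A (4 ^ k) (\<lambda>i. Y i \<omega>))"
    and rec: "AE \<omega> in M. X 1 \<omega> = x \<longrightarrow> infinite {n. X n \<omega> = x}"
    and pos: "\<P>(\<omega> in M. X 1 \<omega> = x) > 0"
  shows "AE \<omega> in M. X 1 \<omega> = x \<longrightarrow> lim_freq A (\<lambda>i. Y i \<omega>) =
    (\<integral>\<omega>. indicator {\<omega> \<in> space M. X 1 \<omega> = x} \<omega> * lim_freq A (\<lambda>i. Y i \<omega>) \<partial>M) / \<P>(\<omega> in M. X 1 \<omega> = x)"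
proof -
  let ?D = "{\<omega> \<in> space M. X 1 \<omega> = x}" and ?L = "\<lambda>\<omega>. lim_freq A (\<lambda>i. Y i \<omega>)"
  define p where "p = prob ?D"
  define c where "c = (\<integral>\<omega>. indicator ?D \<omega> * ?L \<omega> \<partial>M)"
  have p: "p > 0" using pos by (simp add: p_def)
  have D[measurable]: "?D \<in> sets M" by measurable
  have Lm[measurable]: "?L \<in> borel_measurable M" by measurable
  have Lb: "\<bar>?L \<omega>\<bar> \<le> 1" for \<omega> by (simp add: lim_freq_nonneg lim_freq_le_1)
  have DL: "\<bar>indicator ?D \<omega> * ?L \<omega>\<bar> \<le> 1" for \<omega> using Lb by (simp add: indicator_def)
  have DD: "{\<omega> \<in> ?D. Y (0 + i) \<omega> \<in> A} = {\<omega> \<in> space M. X 1 \<omega> = x \<and> Y i \<omega> \<in> A}" for i by auto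
  have eq: "p * (\<integral>\<omega>. indicator ?D \<omega> * ?L \<omega> * emp_freq A (4 ^ k) (\<lambda>i. Y (0 + i) \<omega>) \<partial>M)
      = (\<integral>\<omega>. indicator ?D \<omega> * emp_freq A (4 ^ k) (\<lambda>i. Y (0 + i) \<omega>) \<partial>M) * c" for k
  proof -
    have "(\<integral>\<omega>. indicator ?D \<omega> * emp_freq A (4 ^ k) (\<lambda>i. Y (0 + i) \<omega>) \<partial>M)
        = (\<Sum>i<4 ^ k. prob {\<omega> \<in> space M. X 1 \<omega> = x \<and> Y i \<omega> \<in> A}) / 4 ^ k"
      using integral_indicator_emp_freq[OF A D, of "\<lambda>_. 1" "4 ^ k" 0] unfolding DD by simp
    moreover have "(\<integral>\<omega>. indicator ?D \<omega> * ?L \<omega> * emp_freq A (4 ^ k) (\<lambda>i. Y (0 + i) \<omega>) \<partial>M)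
        = (\<Sum>i<4 ^ k. \<integral>\<omega>. indicator {\<omega> \<in> space M. X 1 \<omega> = x \<and> Y i \<omega> \<in> A} \<omega> * ?L \<omega> \<partial>M) / 4 ^ k"
      using integral_indicator_emp_freq[OF A D Lm Lb, of "4 ^ k" 0] unfolding DD by simp
    ultimately show ?thesis
      using lim_freq_indep_obs[OF A conv rec]
      by (simp add: sum_distrib_left sum_distrib_right p_def c_def)
  qed
  have "(\<lambda>k. p * (\<integral>\<omega>. indicator ?D \<omega> * ?L \<omega> * emp_freq A (4 ^ k) (\<lambda>i. Y (0 + i) \<omega>) \<partial>M))
      \<longlonglongrightarrow> p * (\<integral>\<omega>. indicator ?D \<omega> * ?L \<omega> * ?L \<omega> \<partial>M)"
    using DL by (intro tendsto_mult_left integral_emp_freq_shift_tendsto[OF A conv]) auto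
  moreover have "(\<lambda>k. p * (\<integral>\<omega>. indicator ?D \<omega> * ?L \<omega> * emp_freq A (4 ^ k) (\<lambda>i. Y (0 + i) \<omega>) \<partial>M))
      \<longlonglongrightarrow> c * c"
    unfolding eq c_def
    by (intro tendsto_mult_right integral_emp_freq_shift_tendsto[OF A conv]) (auto simp: indicator_def)
  \<comment> \<open>Divided by \<open>p\<^sup>2\<close>, this says that conditionally on
    \<open>?D\<close> the second moment of \<open>?L\<close> is the square of its mean
    \<open>c / p\<close>. The conditional variance is therefore zero.\<close>
  ultimately have var: "p * (\<integral>\<omega>. indicator ?D \<omega> * ?L \<omega> * ?L \<omega> \<partial>M) = c * c"
    by (rule LIMSEQ_unique)
  have i1: "integrable M (\<lambda>\<omega>. indicator ?D \<omega> * ?L \<omega> * ?L \<omega>)"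
    using mult_mono[OF DL Lb] by (intro integrable_bounded[where c=1]) (auto simp: abs_mult)
  have i2: "integrable M (\<lambda>\<omega>. indicator ?D \<omega> * ?L \<omega>)"
    using DL by (intro integrable_bounded[where c=1]) auto
  have i3: "integrable M (indicator ?D :: _ \<Rightarrow> real)"
    by (intro integrable_bounded[where c=1]) auto
  have exp: "indicator ?D \<omega> * (?L \<omega> - c / p)\<^sup>2
      = indicator ?D \<omega> * ?L \<omega> * ?L \<omega> - 2 * (c / p) * (indicator ?D \<omega> * ?L \<omega>) + (c / p)\<^sup>2 * indicator ?D \<omega>" for \<omega>
    by (simp add: power2_eq_square algebra_simps)
  have i: "integrable M (\<lambda>\<omega>. indicator ?D \<omega> * (?L \<omega> - c / p)\<^sup>2)"
    unfolding exp by (intro Bochner_Integration.integrable_add Bochner_Integration.integrable_diff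
        integrable_mult_right i1 i2 i3)
  have "(\<integral>\<omega>. indicator ?D \<omega> * (?L \<omega> - c / p)\<^sup>2 \<partial>M)
      = (\<integral>\<omega>. indicator ?D \<omega> * ?L \<omega> * ?L \<omega> \<partial>M) - 2 * (c / p) * c + (c / p)\<^sup>2 * p"
    unfolding exp using i1 i2 i3 by (simp add: c_def p_def)
  also have "\<dots> = 0"
    using var p by (simp add: field_simps power2_eq_square)
  finally have "AE \<omega> in M. indicator ?D \<omega> * (?L \<omega> - c / p)\<^sup>2 = 0"
    using integral_nonneg_eq_0_iff_AE[OF i] by simp
  then show ?thesis
    using AE_space unfolding c_def[symmetric] p_def[symmetric]
    by eventually_elim auto
qed

end

section \<open>Laws of sequences and directing measures\<close>

lemma measurable_sequence:
  assumes "\<And>n. Y n \<in> measurable M S"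
  shows "(\<lambda>\<omega> n. Y n \<omega>) \<in> measurable M (PiM UNIV (\<lambda>_. S))"
  by (rule measurable_PiM_single') (auto intro: assms measurable_space[OF assms])

text \<open>\<open>same_fdd\<close> speaks of the index sets \<open>{..N}\<close>, whereas
  uniqueness on the infinite product is tested on cylinders over any finite \<open>J\<close>. An
  \<open>N\<close> bounding \<open>J\<close> translates between the two.\<close>

lemma emeasure_distr_sequence_emb:
  assumes Y: "\<And>n. Y n \<in> measurable M S"
    and J: "finite J" and A: "\<And>i. i \<in> J \<Longrightarrow> A i \<in> sets S" and N: "J \<subseteq> {..N}"
  shows "emeasure (distr M (PiM UNIV (\<lambda>_. S)) (\<lambda>\<omega> n. Y n \<omega>)) (prod_emb UNIV (\<lambda>_. S) J (Pi\<^sub>E J A))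
    = emeasure (distr M (PiM {..N} (\<lambda>_. S)) (\<lambda>\<omega>. \<lambda>i\<in>{..N}. Y i \<omega>)) (prod_emb {..N} (\<lambda>_. S) J (Pi\<^sub>E J A))"
proof -
  have m: "(\<lambda>\<omega>. \<lambda>i\<in>{..N}. Y i \<omega>) \<in> measurable M (PiM {..N} (\<lambda>_. S))"
    by (intro measurable_restrict Y)
  have s: "prod_emb UNIV (\<lambda>_. S) J (Pi\<^sub>E J A) \<in> sets (PiM UNIV (\<lambda>_. S))"
    "prod_emb {..N} (\<lambda>_. S) J (Pi\<^sub>E J A) \<in> sets (PiM {..N} (\<lambda>_. S))"
    using J A N by (auto intro!: sets_PiM_I)
  have "(\<lambda>\<omega> n. Y n \<omega>) -` prod_emb UNIV (\<lambda>_. S) J (Pi\<^sub>E J A) \<inter> space M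
      = (\<lambda>\<omega>. \<lambda>i\<in>{..N}. Y i \<omega>) -` prod_emb {..N} (\<lambda>_. S) J (Pi\<^sub>E J A) \<inter> space M"
    using N[THEN subsetD] measurable_space[OF Y] by (auto simp: prod_emb_def space_PiM PiE_iff)
  then show ?thesis
    by (simp add: emeasure_distr[OF measurable_sequence[OF Y] s(1)] emeasure_distr[OF m s(2)])
qed

lemma same_fdd_imp_distr_sequence_eq:
  assumes "prob_space M" and Y: "\<And>n. Y n \<in> measurable M S" and Y': "\<And>n. Y' n \<in> measurable M' S"
    and fdd: "same_fdd S M Y M' Y'"
  shows "distr M (PiM UNIV (\<lambda>_. S)) (\<lambda>\<omega> n. Y n \<omega>) = distr M' (PiM UNIV (\<lambda>_. S)) (\<lambda>\<omega> n. Y' n \<omega>)"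
proof (rule measure_eqI_PiM_infinite)
  interpret prob_space M by fact
  show "finite_measure (distr M (PiM UNIV (\<lambda>_. S)) (\<lambda>\<omega> n. Y n \<omega>))"
    by (intro prob_space.finite_measure prob_space_distr measurable_sequence Y)
  fix A and J :: "nat set"
  assume J: "finite J" and A: "\<And>i. i \<in> J \<Longrightarrow> A i \<in> sets S"
  define N where "N = Max (insert 0 J)"
  have N: "J \<subseteq> {..N}" using J by (auto simp: N_def)
  show "emeasure (distr M (PiM UNIV (\<lambda>_. S)) (\<lambda>\<omega> n. Y n \<omega>)) (prod_emb UNIV (\<lambda>_. S) J (Pi\<^sub>E J A))
      = emeasure (distr M' (PiM UNIV (\<lambda>_. S)) (\<lambda>\<omega> n. Y' n \<omega>)) (prod_emb UNIV (\<lambda>_. S) J (Pi\<^sub>E J A))"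
    using emeasure_distr_sequence_emb[OF Y J A N] emeasure_distr_sequence_emb[OF Y' J A N] fdd
    by (simp add: same_fdd_def)
qed auto

text \<open>For an injection \<open>\<sigma>\<close>, exchangeability gives the reindexed process
  the same finite-dimensional distributions as \<open>Y\<close>, hence the same law on infinite
  sequences.\<close>

lemma exchangeable_law_distr:
  assumes M: "prob_space M" and Y: "\<And>n. Y n \<in> measurable M S" and exch: "exchangeable M S Y"
  shows "exchangeable_law (distr M (PiM UNIV (\<lambda>_. S)) (\<lambda>\<omega> n. Y n \<omega>)) S"
proof -
  let ?S = "PiM (UNIV :: nat set) (\<lambda>_. S)"
  interpret prob_space M by fact
  interpret Q: prob_space "distr M ?S (\<lambda>\<omega> n. Y n \<omega>)"
    by (intro prob_space_distr measurable_sequence Y)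
  show ?thesis
  proof
    fix \<sigma> :: "nat \<Rightarrow> nat" assume "inj \<sigma>"
    have "same_fdd S M (\<lambda>n. Y (\<sigma> n)) M Y"
      unfolding same_fdd_def
    proof
      fix N
      have "inj_on \<sigma> {..<Suc N}" using \<open>inj \<sigma>\<close> by (rule inj_on_subset) simp
      with exch show "distr M (PiM {..N} (\<lambda>_. S)) (\<lambda>\<omega>. \<lambda>i\<in>{..N}. Y (\<sigma> i) \<omega>)
          = distr M (PiM {..N} (\<lambda>_. S)) (\<lambda>\<omega>. \<lambda>i\<in>{..N}. Y i \<omega>)"
        unfolding exchangeable_def lessThan_Suc_atMost[symmetric] by blast
    qed
    then have "distr M ?S (\<lambda>\<omega> n. Y (\<sigma> n) \<omega>) = distr M ?S (\<lambda>\<omega> n. Y n \<omega>)"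
      by (intro same_fdd_imp_distr_sequence_eq M Y)
    moreover have "(\<lambda>s. s \<circ> \<sigma>) \<in> measurable ?S ?S"
      by (rule measurable_PiM_single') (auto simp: space_PiM)
    ultimately show "distr (distr M ?S (\<lambda>\<omega> n. Y n \<omega>)) ?S (\<lambda>s. s \<circ> \<sigma>) = distr M ?S (\<lambda>\<omega> n. Y n \<omega>)"
      by (simp add: distr_distr measurable_sequence Y comp_def)
  qed simp
qed

text \<open>Frequencies of disjoint sets add only up to a null set depending on the sets;
  integrating over \<open>D\<close> removes these null sets and gives finite additivity. Countable
  additivity then follows from continuity at the empty set.\<close>

lemma (in prob_space) ex_lim_freq_measure:
  assumes Y[measurable]: "\<And>n. Y n \<in> measurable M S"
    and conv: "\<And>A. A \<in> sets S \<Longrightarrow> AE \<omega> in M. convergent (\<lambda>k. emp_freq A (4 ^ k) (\<lambda>i. Y i \<omega>))"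
    and mean: "\<And>A. A \<in> sets S \<Longrightarrow> (\<integral>\<omega>. lim_freq A (\<lambda>i. Y i \<omega>) \<partial>M) = \<P>(\<omega> in M. Y 0 \<omega> \<in> A)"
    and D[measurable]: "D \<in> events" and pos: "prob D > 0"
  shows "\<exists>\<nu>\<in>space (prob_algebra S). \<forall>A\<in>sets S.
    measure \<nu> A = (\<integral>\<omega>. indicator D \<omega> * lim_freq A (\<lambda>i. Y i \<omega>) \<partial>M) / prob D"
proof -
  let ?L = "\<lambda>A \<omega>. lim_freq A (\<lambda>i. Y i \<omega>)"
  define a where "a A = (\<integral>\<omega>. indicator D \<omega> * ?L A \<omega> \<partial>M) / prob D" for A
  have int: "integrable M (?L A)" "integrable M (\<lambda>\<omega>. indicator D \<omega> * ?L A \<omega>)" if [measurable]: "A \<in> sets S" for A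
    by (auto intro!: integrable_const_bound[where B=1] simp: lim_freq_nonneg lim_freq_le_1 indicator_def)
  have a0: "0 \<le> a A" for A
    using pos by (auto simp: a_def lim_freq_nonneg intro!: divide_nonneg_pos integral_nonneg_AE)
  have emp: "?L {} \<omega> = 0" for \<omega>
    using lim_freq_tendsto[of "{}" "\<lambda>i. Y i \<omega>"] by (simp add: emp_freq_def convergent_const LIMSEQ_const_iff)
  have total: "?L (space S) \<omega> = 1" if "\<omega> \<in> space M" for \<omega>
  proof -
    have "emp_freq (space S) (4 ^ k) (\<lambda>i. Y i \<omega>) = 1" for k
      using measurable_space[OF Y that] by (simp add: emp_freq_def)
    then show ?thesis
      using lim_freq_tendsto[of "space S" "\<lambda>i. Y i \<omega>"] by (simp add: convergent_const LIMSEQ_const_iff)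
  qed
  have add: "a (A \<union> B) = a A + a B" if AB: "A \<in> sets S" "B \<in> sets S" "A \<inter> B = {}" for A B
  proof -
    have "A \<union> B \<in> sets S" using AB by simp
    have "AE \<omega> in M. ?L (A \<union> B) \<omega> = ?L A \<omega> + ?L B \<omega>"
      using conv[OF AB(1)] conv[OF AB(2)] conv[OF \<open>A \<union> B \<in> sets S\<close>]
    proof eventually_elim
      case (elim \<omega>)
      have "emp_freq (A \<union> B) n s = emp_freq A n s + emp_freq B n s" for n s
        using AB(3) by (simp add: emp_freq_def indicator_add[symmetric] sum.distrib add_divide_distrib)
      with tendsto_add[OF elim(1,2)[THEN lim_freq_tendsto]] lim_freq_tendsto[OF elim(3)]
      show ?case using LIMSEQ_unique by fastforce
    qed
    then have "(\<integral>\<omega>. indicator D \<omega> * ?L (A \<union> B) \<omega> \<partial>M) = (\<integral>\<omega>. indicator D \<omega> * ?L A \<omega> + indicator D \<omega> * ?L B \<omega> \<partial>M)"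
      using AB by (intro integral_cong_AE) (auto simp: algebra_simps)
    also have "\<dots> = (\<integral>\<omega>. indicator D \<omega> * ?L A \<omega> \<partial>M) + (\<integral>\<omega>. indicator D \<omega> * ?L B \<omega> \<partial>M)"
      using AB by (intro Bochner_Integration.integral_add int)
    finally show ?thesis by (simp add: a_def add_divide_distrib)
  qed
  \<comment> \<open>Domination by a multiple of the law of \<open>Y 0\<close> forces
    \<open>a\<close> to tend to 0 along sets decreasing to the empty set.\<close>
  have dom: "a A \<le> \<P>(\<omega> in M. Y 0 \<omega> \<in> A) / prob D" if A: "A \<in> sets S" for A
    unfolding a_def mean[OF A, symmetric]
    by (intro divide_right_mono integral_mono int A)
       (auto simp: lim_freq_nonneg indicator_def)
  have ca: "countably_additive (sets S) (\<lambda>A. ennreal (a A))"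
  proof (rule sets.empty_continuous_imp_countably_additive)
    show "positive (sets S) (\<lambda>A. ennreal (a A))"
      by (simp add: positive_def a_def emp)
    show "additive (sets S) (\<lambda>A. ennreal (a A))"
      by (simp add: additive_def add a0)
    fix A :: "nat \<Rightarrow> _" assume A: "range A \<subseteq> sets S" "decseq A" "(\<Inter>i. A i) = {}"
    then have Am: "A i \<in> sets S" for i by auto
    let ?E = "\<lambda>i. {\<omega> \<in> space M. Y 0 \<omega> \<in> A i}"
    have "(\<lambda>i. prob (?E i)) \<longlonglongrightarrow> prob (\<Inter>i. ?E i)"
      using A Am by (intro finite_Lim_measure_decseq) (auto simp: decseq_def)
    moreover have "(\<Inter>i. ?E i) = {}" using A(3) by auto
    ultimately have "(\<lambda>i. prob (?E i) / prob D) \<longlonglongrightarrow> 0"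
      by (auto intro: tendsto_divide_zero)
    then have "(\<lambda>i. a (A i)) \<longlonglongrightarrow> 0"
      by (rule tendsto_sandwich[rotated 2, OF tendsto_const]) (auto simp: a0 dom Am)
    then show "(\<lambda>i. ennreal (a (A i))) \<longlonglongrightarrow> 0"
      using tendsto_ennrealI[of "\<lambda>i. a (A i)" 0] by simp
  qed simp
  define \<nu> where "\<nu> = measure_of (space S) (sets S) (\<lambda>A. ennreal (a A))"
  have e\<nu>: "emeasure \<nu> A = ennreal (a A)" if "A \<in> sets S" for A
    using ca that sets.space_closed[of S] sets.sigma_algebra_axioms
    by (intro emeasure_measure_of[OF \<nu>_def]) (auto simp: positive_def a_def emp \<nu>_def)
  have sp: "space \<nu> = space S" "sets \<nu> = sets S" by (auto simp: \<nu>_def)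
  have "(\<integral>\<omega>. indicator D \<omega> * ?L (space S) \<omega> \<partial>M) = (\<integral>\<omega>. indicator D \<omega> \<partial>M)"
    by (intro Bochner_Integration.integral_cong) (auto simp: total)
  then have "emeasure \<nu> (space \<nu>) = 1"
    using pos by (simp add: sp e\<nu> a_def)
  then have "\<nu> \<in> space (prob_algebra S)"
    by (simp add: space_prob_algebra sp prob_spaceI)
  moreover have "measure \<nu> A = a A" if "A \<in> sets S" for A
    using e\<nu>[OF that] a0 by (simp add: measure_def)
  ultimately show ?thesis by (auto simp: a_def)
qed

section \<open>Identifying a measure by countably many of its values\<close>

lemma sets_Collect_ball_countable:
  assumes "countable F" and P: "\<And>A. A \<in> F \<Longrightarrow> {\<omega> \<in> space N. P A \<omega>} \<in> sets N"
  shows "{\<omega> \<in> space N. \<forall>A\<in>F. P A \<omega>} \<in> sets N"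
proof -
  have "{\<omega> \<in> space N. \<forall>A\<in>F. P A \<omega>} = space N - (\<Union>A\<in>F. space N - {\<omega> \<in> space N. P A \<omega>})"
    by auto
  also have "\<dots> \<in> sets N"
    using assms by (intro sets.Diff sets.top sets.countable_UN') auto
  finally show ?thesis .
qed

text \<open>One distinguishing set is chosen for each of the countably many pairs.\<close>

lemma ex_countable_separating_sets:
  assumes C: "countable C" "C \<subseteq> space (prob_algebra S)"
  obtains F where "countable F" "F \<subseteq> sets S"
    and "\<And>c d. c \<in> C \<Longrightarrow> d \<in> C \<Longrightarrow> (\<And>A. A \<in> F \<Longrightarrow> measure c A = measure d A) \<Longrightarrow> c = d"
proof -
  have "\<exists>A\<in>sets S. c \<noteq> d \<longrightarrow> measure c A \<noteq> measure d A" if "c \<in> C" "d \<in> C" for c d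
  proof (rule ccontr)
    assume *: "\<not> ?thesis"
    from that C have cd: "sets c = sets S" "sets d = sets S" "prob_space c" "prob_space d"
      by (auto simp: space_prob_algebra)
    interpret c: prob_space c by fact
    interpret d: prob_space d by fact
    have "c = d"
      using * cd by (intro measure_eqI) (auto simp: c.emeasure_eq_measure d.emeasure_eq_measure)
    with * show False by auto
  qed
  then obtain sep where sep: "\<And>c d. c \<in> C \<Longrightarrow> d \<in> C \<Longrightarrow> sep c d \<in> sets S \<and> (c \<noteq> d \<longrightarrow> measure c (sep c d) \<noteq> measure d (sep c d))"
    by metis
  show thesis
  proof (rule that[of "(\<lambda>(c, d). sep c d) ` (C \<times> C)"])
    fix c d assume "c \<in> C" "d \<in> C"
      "\<And>A. A \<in> (\<lambda>(c, d). sep c d) ` (C \<times> C) \<Longrightarrow> measure c A = measure d A"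
    then show "c = d" using sep[of c d] by force
  qed (use C sep in auto)
qed

text \<open>This inverts the map sending \<open>c \<in> C\<close> to its values on \<open>F\<close>.
  The argument is a mere set function, so that both a measure and the limiting frequencies can be
  decoded. The default lies in \<open>C\<close> as soon as \<open>C\<close> is nonempty, which makes
  the result \<open>C\<close>-valued everywhere.\<close>

definition decode :: "'s set set \<Rightarrow> 's measure set \<Rightarrow> ('s set \<Rightarrow> real) \<Rightarrow> 's measure" where
  "decode F C l =
     (if \<exists>c\<in>C. \<forall>A\<in>F. l A = measure c A then SOME c. c \<in> C \<and> (\<forall>A\<in>F. l A = measure c A)
      else SOME c. c \<in> C)"

lemma decode_eq:
  assumes sep: "\<And>c d. c \<in> C \<Longrightarrow> d \<in> C \<Longrightarrow> (\<And>A. A \<in> F \<Longrightarrow> measure c A = measure d A) \<Longrightarrow> c = d"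
    and c: "c \<in> C" "\<And>A. A \<in> F \<Longrightarrow> l A = measure c A"
  shows "decode F C l = c"
proof -
  have "(SOME c. c \<in> C \<and> (\<forall>A\<in>F. l A = measure c A)) = c"
    using c by (intro some_equality) (auto intro!: sep)
  with c show ?thesis unfolding decode_def by auto
qed

lemma measurable_decode:
  assumes C: "countable C" "C \<noteq> {}" and F: "countable F"
    and sep: "\<And>c d. c \<in> C \<Longrightarrow> d \<in> C \<Longrightarrow> (\<And>A. A \<in> F \<Longrightarrow> measure c A = measure d A) \<Longrightarrow> c = d"
    and l: "\<And>A. A \<in> F \<Longrightarrow> (\<lambda>\<omega>. l \<omega> A) \<in> borel_measurable N"
  shows "(\<lambda>\<omega>. decode F C (l \<omega>)) \<in> measurable N (count_space C)"
proof -
  define T where "T c = {\<omega> \<in> space N. \<forall>A\<in>F. l \<omega> A = measure c A}" for c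
  have T: "T c \<in> sets N" for c
  proof -
    have "{\<omega> \<in> space N. l \<omega> A = measure c A} \<in> sets N" if "A \<in> F" for A
      using l[OF that] by measurable
    then show ?thesis unfolding T_def using F by (intro sets_Collect_ball_countable)
  qed
  have U: "(\<Union>d\<in>C. T d) \<in> sets N"
    using C T by (intro sets.countable_UN') auto
  let ?c0 = "SOME c. c \<in> C"
  have c0: "?c0 \<in> C" using C by (auto intro: someI_ex)
  have dT: "decode F C (l \<omega>) = d" if "d \<in> C" "\<omega> \<in> T d" for \<omega> d
    using that by (intro decode_eq sep) (auto simp: T_def)
  have dn: "decode F C (l \<omega>) = ?c0" if "\<omega> \<in> space N" "\<omega> \<notin> (\<Union>d\<in>C. T d)" for \<omega>
    using that by (auto simp: decode_def T_def)
  \<comment> \<open>The default measure also collects all points where no element of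
    \<open>C\<close> matches.\<close>
  have "(\<lambda>\<omega>. decode F C (l \<omega>)) -` {c} \<inter> space N = T c \<union> (if c = ?c0 then space N - (\<Union>d\<in>C. T d) else {})"
    if "c \<in> C" for c
  proof (rule set_eqI)
    fix \<omega>
    show "\<omega> \<in> (\<lambda>\<omega>. decode F C (l \<omega>)) -` {c} \<inter> space N \<longleftrightarrow>
        \<omega> \<in> T c \<union> (if c = ?c0 then space N - (\<Union>d\<in>C. T d) else {})"
    proof (cases "\<omega> \<in> (\<Union>d\<in>C. T d)")
      case True
      then obtain d where d: "d \<in> C" "\<omega> \<in> T d" by auto
      moreover have "\<omega> \<in> T c \<longleftrightarrow> c = d" using dT[OF d] dT[OF that] d by auto
      moreover have "\<omega> \<in> space N" using d by (simp add: T_def)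
      ultimately show ?thesis using dT[OF d] by auto
    next
      case False
      then show ?thesis using dn[of \<omega>] that T sets.sets_into_space[OF T, of c] by auto
    qed
  qed
  moreover have "decode F C (l \<omega>) \<in> C" if "\<omega> \<in> space N" for \<omega>
    using dT dn[OF that] c0 by (metis UN_E)
  ultimately show ?thesis
    using T U C by (subst measurable_count_space_eq_countable) auto
qed

section \<open>The two implications\<close>

lemma sigma_finite_subalgebra_vimage:
  assumes "prob_space M" and p: "p \<in> measurable M N"
  shows "sigma_finite_subalgebra M (vimage_algebra (space M) p N)"
proof -
  interpret prob_space M by fact
  have "subalgebra M (vimage_algebra (space M) p N)"
    using measurable_sets[OF p] measurable_space[OF p]
    by (auto simp: subalgebra_def sets_vimage_algebra2)
  then show ?thesis
    by (intro finite_measure_subalgebra_is_sigma_finite)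
       (simp add: finite_measure_subalgebra_def finite_measure_axioms finite_measure_subalgebra_axioms_def)
qed

text \<open>The directing measure lies in \<open>C\<close> only almost surely, and singletons need
  not be measurable in \<open>prob_algebra S\<close>. The chain is therefore a decoded version
  \<open>X\<close> of \<open>p\<close>: it takes values in \<open>C\<close> everywhere, is
  measurable for the discrete \<sigma>-field, and equals \<open>p\<close> almost surely. The states
  are themselves measures, each its own read-out.\<close>

lemma countable_iid_mixture_imp_recurrent_hmm:
  fixes M :: "'w measure" and S :: "'s measure"
  assumes M: "prob_space M" and Y[measurable]: "\<And>n. Y n \<in> measurable M S"
    and mix: "countable_iid_mixture M S Y"
  shows "recurrent_hmm M S Y"
proof -
  interpret prob_space M by fact
  obtain p C where p[measurable]: "p \<in> measurable M (prob_algebra S)"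
    and mix: "\<And>N A. \<forall>i\<le>N. A i \<in> sets S \<Longrightarrow> (AE \<omega> in M.
           real_cond_exp M (vimage_algebra (space M) p (prob_algebra S))
             (indicator {\<omega> \<in> space M. \<forall>i\<le>N. Y i \<omega> \<in> A i}) \<omega>
           = (\<Prod>i\<le>N. measure (p \<omega>) (A i)))"
    and C: "C \<subseteq> space (prob_algebra S)" "countable C" and pC: "AE \<omega> in M. p \<omega> \<in> C"
    using mix unfolding countable_iid_mixture_def iid_mixture_by_def by blast
  define G where "G = vimage_algebra (space M) p (prob_algebra S)"
  interpret G: sigma_finite_subalgebra M G
    unfolding G_def using M p by (rule sigma_finite_subalgebra_vimage)
  have C0: "C \<noteq> {}" using pC by auto
  obtain F where F: "countable F" "F \<subseteq> sets S"
    and sep: "\<And>c d. c \<in> C \<Longrightarrow> d \<in> C \<Longrightarrow> (\<And>A. A \<in> F \<Longrightarrow> measure c A = measure d A) \<Longrightarrow> c = d"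
    using ex_countable_separating_sets[OF C(2,1)] by metis
  define X where "X \<omega> = decode F C (\<lambda>A. measure (p \<omega>) A)" for \<omega>
  have pG: "p \<in> measurable G (prob_algebra S)"
    unfolding G_def using measurable_space[OF p] by (intro measurable_vimage_algebra1) auto
  have XG: "X \<in> measurable G (count_space C)"
    unfolding X_def using F
    by (intro measurable_decode C C0 sep measurable_compose[OF pG] measurable_measure_prob_algebra) auto
  have XM: "X \<in> measurable M (count_space C)"
    using measurable_from_subalg[OF G.subalg XG] .
  have spG: "space G = space M" by (simp add: G_def)
  have Xp: "AE \<omega> in M. X \<omega> = p \<omega>"
    using pC unfolding X_def by eventually_elim (intro decode_eq sep, auto)
  have XcG: "{\<omega> \<in> space M. X \<omega> = c} \<in> sets G" if "c \<in> C" for c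
    using measurable_sets[OF XG, of "{c}"] that
    by (simp add: spG vimage_def Int_def conj_commute)
  have XcM[measurable]: "{\<omega> \<in> space M. X \<omega> = c} \<in> sets M" if "c \<in> C" for c
    using XcG[OF that] G.subalg by (auto simp: subalgebra_def)
  have joint: "\<P>(\<omega> in M. (\<forall>i\<le>N. Y i \<omega> \<in> A i) \<and> X \<omega> = c) = \<P>(\<omega> in M. X \<omega> = c) * (\<Prod>i\<le>N. measure c (A i))"
    if c: "c \<in> C" and A: "\<forall>i\<le>N. A i \<in> sets S" for c N A
  proof -
    define E where "E = {\<omega> \<in> space M. \<forall>i\<le>N. Y i \<omega> \<in> A i}"
    let ?D = "{\<omega> \<in> space M. X \<omega> = c}"
    have Em: "E \<in> sets M"
      unfolding E_def
    proof (rule sets.sets_Collect_countable_All[where 'i=nat])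
      show "{\<omega> \<in> space M. i \<le> N \<longrightarrow> Y i \<omega> \<in> A i} \<in> sets M" for i
        using A measurable_sets[OF Y, of "A i" i]
        by (cases "i \<le> N") (simp_all add: vimage_def Int_def conj_commute)
    qed
    note [measurable] = Em XcM[OF c]
    have Ei: "integrable M (indicator E :: _ \<Rightarrow> real)"
      by (rule integrable_const_bound[where B=1]) auto
    have "{\<omega> \<in> space M. (\<forall>i\<le>N. Y i \<omega> \<in> A i) \<and> X \<omega> = c} = ?D \<inter> E"
      by (auto simp: E_def)
    then have "\<P>(\<omega> in M. (\<forall>i\<le>N. Y i \<omega> \<in> A i) \<and> X \<omega> = c) = (\<integral>\<omega>\<in>?D. indicator E \<omega> \<partial>M)"
      by (simp add: set_lebesgue_integral_def indicator_inter_arith[symmetric])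
    \<comment> \<open>This exchange is allowed because \<open>X\<close> is measurable with respect
      to \<sigma>(p), so that \<open>?D\<close> belongs to \<open>G\<close>.\<close>
    also have "\<dots> = (\<integral>\<omega>\<in>?D. real_cond_exp M G (indicator E) \<omega> \<partial>M)"
      using Ei XcG[OF c] by (rule G.real_cond_exp_intA)
    also have "\<dots> = (\<integral>\<omega>\<in>?D. (\<Prod>i\<le>N. measure c (A i)) \<partial>M)"
      unfolding set_lebesgue_integral_def
    proof (rule integral_cong_AE)
      show "AE \<omega> in M. indicator ?D \<omega> *\<^sub>R real_cond_exp M G (indicator E) \<omega>
          = indicator ?D \<omega> *\<^sub>R (\<Prod>i\<le>N. measure c (A i))"
        using mix[OF A] Xp unfolding G_def E_def by eventually_elim (auto simp: indicator_def)
    qed measurable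
    finally show ?thesis by (simp add: set_lebesgue_integral_def mult.commute)
  qed
  have single: "\<P>(\<omega> in M. Y i \<omega> \<in> B \<bar> X \<omega> = c) = measure c B"
    if c: "c \<in> C" and B: "B \<in> sets S" and pos: "\<P>(\<omega> in M. X \<omega> = c) > 0" for c B i
  proof -
    let ?A = "(\<lambda>_. space S)(i := B)"
    have "{\<omega> \<in> space M. Y i \<omega> \<in> B \<and> X \<omega> = c} = {\<omega> \<in> space M. (\<forall>l\<le>i. Y l \<omega> \<in> ?A l) \<and> X \<omega> = c}"
      using measurable_space[OF Y] by auto
    moreover have "measure c (space S) = 1"
      using c C in_space_prob_algebra[of c S] by (auto simp: measure_def)
    then have "(\<Prod>l\<le>i. measure c (?A l)) = measure c B"
      by (subst prod.remove[of _ i]) auto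
    ultimately show ?thesis
      using joint[OF c, of i ?A] B pos by (simp add: cond_prob_def)
  qed
  show ?thesis
  proof (rule recurrent_hmmI)
    show "same_fdd S M Y M Y" by (simp add: same_fdd_def)
    show "recurrent_chain M C (\<lambda>_. X)"
      unfolding recurrent_chain_def
    proof (intro ballI impI)
      fix x assume pos: "\<P>(\<omega> in M. X \<omega> = x) > 0"
      have "{\<omega> \<in> space M. infinite {n :: nat. X \<omega> = x} \<and> X \<omega> = x} = {\<omega> \<in> space M. X \<omega> = x}"
        by auto
      with pos show "\<P>(\<omega> in M. infinite {n :: nat. X \<omega> = x} \<bar> X \<omega> = x) = 1"
        by (simp add: cond_prob_def)
    qed
    have chain: "homogeneous_markov_chain M C (\<lambda>_. X)"
      unfolding homogeneous_markov_chain_def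
    proof (intro conjI exI[of _ return_pmf] allI impI ballI C XM)
      fix n :: nat and x y
      assume pos: "\<P>(\<omega> in M. \<forall>i\<le>n. X \<omega> = x i) > 0"
      show "\<P>(\<omega> in M. X \<omega> = y \<bar> \<forall>i\<le>n. X \<omega> = x i) = pmf (return_pmf (x n)) y"
      proof (cases "y = x n")
        case True
        then have "{\<omega> \<in> space M. X \<omega> = y \<and> (\<forall>i\<le>n. X \<omega> = x i)} = {\<omega> \<in> space M. \<forall>i\<le>n. X \<omega> = x i}"
          by auto
        with True pos show ?thesis by (simp add: cond_prob_def)
      next
        case False
        then have "{\<omega> \<in> space M. X \<omega> = y \<and> (\<forall>i\<le>n. X \<omega> = x i)} = {}" by auto
        then have "\<P>(\<omega> in M. X \<omega> = y \<and> (\<forall>i\<le>n. X \<omega> = x i)) = 0" by (simp only: measure_empty)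
        with False show ?thesis by (simp add: cond_prob_def indicator_def)
      qed
    qed simp
    have prod: "\<P>(\<omega> in M. \<forall>i\<le>N. Y i \<omega> \<in> B i \<bar> \<forall>i\<le>N. X \<omega> = x i)
        = (\<Prod>i\<le>N. \<P>(\<omega> in M. Y i \<omega> \<in> B i \<bar> X \<omega> = x i))"
      if x: "\<forall>i\<le>N. x i \<in> C" and B: "\<forall>i\<le>N. B i \<in> sets S"
        and pos: "\<P>(\<omega> in M. \<forall>i\<le>N. X \<omega> = x i) > 0" for N x B
    proof -
      \<comment> \<open>As \<open>X\<close> does not change with time, a path of positive
        probability is constant.\<close>
      have "{\<omega> \<in> space M. \<forall>i\<le>N. X \<omega> = x i} \<noteq> {}" using pos by force
      then obtain \<omega> where "\<And>i. i \<le> N \<Longrightarrow> x i = X \<omega>" by (metis (mono_tags, lifting) Collect_empty_eq)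
      then have xi: "x i = x 0" if "i \<le> N" for i
        using that by simp
      then have eq: "(\<forall>i\<le>N. X \<omega> = x i) \<longleftrightarrow> X \<omega> = x 0" for \<omega> by (metis le0)
      have c: "x 0 \<in> C" using x by simp
      have "(\<Prod>i\<le>N. \<P>(\<omega> in M. Y i \<omega> \<in> B i \<bar> X \<omega> = x i)) = (\<Prod>i\<le>N. measure (x 0) (B i))"
      proof (intro prod.cong refl)
        fix i assume "i \<in> {..N}"
        with pos B c show "\<P>(\<omega> in M. Y i \<omega> \<in> B i \<bar> X \<omega> = x i) = measure (x 0) (B i)"
          unfolding eq by (subst xi) (auto intro!: single)
      qed
      then show ?thesis
        using joint[OF c B] pos unfolding eq by (simp add: cond_prob_def)
    qed
    show "hidden_markov_pair M S C (\<lambda>_. X) Y"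
      unfolding hidden_markov_pair_def
      using C by (intro conjI M chain exI[of _ "\<lambda>c. c"]) (use prod single Y in auto)
  qed
qed

lemma recurrent_hmm_imp_countable_iid_mixture:
  fixes M :: "'w measure" and S :: "'s measure"
  assumes M: "prob_space M" and Y[measurable]: "\<And>n. Y n \<in> measurable M S"
    and exch: "exchangeable M S Y" and hmm: "recurrent_hmm M S Y"
  shows "countable_iid_mixture M S Y"
proof -
  obtain M' :: "(nat \<Rightarrow> nat \<times> 's) measure" and XX :: "nat set" and X Y'
    where pair: "hidden_markov_pair M' S XX X Y'" and rec: "recurrent_chain M' XX X" and fdd: "same_fdd S M Y M' Y'"
    using hmm unfolding recurrent_hmm_def by blast
  have chain: "homogeneous_markov_chain M' XX X" and M': "prob_space M'"
    and Y': "\<And>n. Y' n \<in> measurable M' S"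
    and obs: "\<And>N x B. (\<forall>i\<le>N. x i \<in> XX) \<Longrightarrow> (\<forall>i\<le>N. B i \<in> sets S) \<Longrightarrow>
        \<P>(\<omega> in M'. \<forall>i\<le>N. X i \<omega> = x i) > 0 \<Longrightarrow>
        \<P>(\<omega> in M'. \<forall>i\<le>N. Y' i \<omega> \<in> B i \<bar> \<forall>i\<le>N. X i \<omega> = x i) =
          (\<Prod>i\<le>N. \<P>(\<omega> in M'. Y' i \<omega> \<in> B i \<bar> X i \<omega> = x i))"
    using pair unfolding hidden_markov_pair_def by blast+
  obtain f where f: "\<And>x. x \<in> XX \<Longrightarrow> f x \<in> space (prob_algebra S)"
    "\<And>n x B. x \<in> XX \<Longrightarrow> B \<in> sets S \<Longrightarrow> \<P>(\<omega> in M'. X n \<omega> = x) > 0 \<Longrightarrow>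
       \<P>(\<omega> in M'. Y' n \<omega> \<in> B \<bar> X n \<omega> = x) = measure (f x) B"
    using pair unfolding hidden_markov_pair_def by blast
  have XX: "countable XX" "\<And>n. X n \<in> measurable M' (count_space XX)"
    using chain unfolding homogeneous_markov_chain_def by blast+
  obtain K where K: "\<And>n x y. (\<forall>i\<le>n. x i \<in> XX) \<Longrightarrow> y \<in> XX \<Longrightarrow>
      \<P>(\<omega> in M'. \<forall>i\<le>n. X i \<omega> = x i) > 0 \<Longrightarrow>
      \<P>(\<omega> in M'. X (Suc n) \<omega> = y \<bar> \<forall>i\<le>n. X i \<omega> = x i) = pmf (K (x n)) y"
    using chain unfolding homogeneous_markov_chain_def by blast
  interpret M: prob_space M by fact
  interpret hidden_markov M' S XX X Y' K f
    by (intro hidden_markov.intro hidden_markov_axioms.intro M') (use XX Y' K obs f in blast)+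
  let ?S = "PiM (UNIV :: nat set) (\<lambda>_. S)"
  define Q where "Q = distr M ?S (\<lambda>\<omega> n. Y n \<omega>)"
  have Q': "Q = distr M' ?S (\<lambda>\<omega> n. Y' n \<omega>)"
    unfolding Q_def using M Y Y' fdd by (rule same_fdd_imp_distr_sequence_eq)
  note mY = measurable_sequence[of Y, OF Y] and mY' = measurable_sequence[of Y', OF Y']
  interpret Q: exchangeable_law Q S
    unfolding Q_def using M Y exch by (rule exchangeable_law_distr)
  have conv: "AE \<omega> in M'. convergent (\<lambda>k. emp_freq A (4 ^ k) (\<lambda>i. Y' i \<omega>))" if "A \<in> sets S" for A
    using Q.AE_convergent_emp_freq[OF that] unfolding Q' by (rule AE_distrD[OF mY'])
  have mean: "(\<integral>\<omega>. lim_freq A (\<lambda>i. Y' i \<omega>) \<partial>M') = \<P>(\<omega> in M'. Y' 0 \<omega> \<in> A)" if [measurable]: "A \<in> sets S" for A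
  proof -
    have "(\<integral>\<omega>. lim_freq A (\<lambda>i. Y' i \<omega>) \<partial>M') = (\<integral>s. lim_freq A s \<partial>Q)"
      unfolding Q' by (rule integral_distr[OF mY', symmetric]) measurable
    also have "\<dots> = (\<integral>s. indicator A (s 0) \<partial>Q)"
      using Q.integral_prod_indicator_eq_lim_freq[of 1 "\<lambda>_. A" "\<lambda>_. 1" 1] by simp
    also have "\<dots> = (\<integral>\<omega>. indicator A (Y' 0 \<omega>) \<partial>M')"
      unfolding Q' by (rule integral_distr[OF mY']) measurable
    also have "\<dots> = (\<integral>\<omega>. indicator {\<omega> \<in> space M'. Y' 0 \<omega> \<in> A} \<omega> \<partial>M')"
      by (intro Bochner_Integration.integral_cong) (auto simp: indicator_def)
    finally show ?thesis by simp
  qed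
  \<comment> \<open>These are the states to which the recurrence hypothesis applies. The remaining
    states are countably many null events at time 1.\<close>
  define XX1 where "XX1 = {x \<in> XX. \<P>(\<omega> in M'. X 1 \<omega> = x) > 0}"
  have recAE: "AE \<omega> in M'. X 1 \<omega> = x \<longrightarrow> infinite {n. X n \<omega> = x}" if "x \<in> XX1" for x
  proof -
    have [measurable]: "Measurable.pred M' (\<lambda>\<omega>. infinite {n. X n \<omega> = x})"
      unfolding infinite_nat_iff_unbounded mem_Collect_eq by measurable
    have "\<P>(\<omega> in M'. infinite {n. X n \<omega> = x} \<bar> X 1 \<omega> = x) = 1"
      using rec that unfolding recurrent_chain_def XX1_def by blast
    then have "\<P>(\<omega> in M'. infinite {n. X n \<omega> = x} \<and> X 1 \<omega> = x) = \<P>(\<omega> in M'. X 1 \<omega> = x)"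
      using that by (simp add: cond_prob_def XX1_def)
    moreover have "\<P>(\<omega> in M'. X 1 \<omega> = x)
        = \<P>(\<omega> in M'. infinite {n. X n \<omega> = x} \<and> X 1 \<omega> = x) + \<P>(\<omega> in M'. finite {n. X n \<omega> = x} \<and> X 1 \<omega> = x)"
      by (subst measure_Union[symmetric]) (auto simp: emeasure_eq_measure intro!: arg_cong[where f="measure M'"])
    ultimately have "\<P>(\<omega> in M'. finite {n. X n \<omega> = x} \<and> X 1 \<omega> = x) = 0" by simp
    then have "AE \<omega> in M'. \<not> (finite {n. X n \<omega> = x} \<and> X 1 \<omega> = x)"
      by (intro AE_iff_measurable[THEN iffD2]) (auto simp: emeasure_eq_measure)
    then show ?thesis by eventually_elim auto
  qed
  let ?\<mu> = "\<lambda>x A. (\<integral>\<omega>. indicator {\<omega> \<in> space M'. X 1 \<omega> = x} \<omega> * lim_freq A (\<lambda>i. Y' i \<omega>) \<partial>M')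
      / \<P>(\<omega> in M'. X 1 \<omega> = x)"
  have "\<exists>\<nu>\<in>space (prob_algebra S). \<forall>A\<in>sets S. measure \<nu> A = ?\<mu> x A" if "x \<in> XX1" for x
  proof (rule ex_lim_freq_measure[OF Y' conv mean])
    show "{\<omega> \<in> space M'. X 1 \<omega> = x} \<in> sets M'" by measurable
    show "\<P>(\<omega> in M'. X 1 \<omega> = x) > 0" using that by (simp add: XX1_def)
  qed
  then have "\<forall>x\<in>XX1. \<exists>\<nu>. \<nu> \<in> space (prob_algebra S) \<and> (\<forall>A\<in>sets S. measure \<nu> A = ?\<mu> x A)"
    by blast
  from bchoice[OF this] obtain \<nu> where \<nu>: "\<And>x. x \<in> XX1 \<Longrightarrow> \<nu> x \<in> space (prob_algebra S)"
    and \<nu>_eq: "\<And>x A. x \<in> XX1 \<Longrightarrow> A \<in> sets S \<Longrightarrow> measure (\<nu> x) A = ?\<mu> x A"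
    by blast
  define C where "C = \<nu> ` XX1"
  have XX1: "countable XX1" using XX by (simp add: XX1_def)
  have C: "countable C" "C \<subseteq> space (prob_algebra S)" using XX1 \<nu> by (auto simp: C_def)
  \<comment> \<open>One measure in \<open>C\<close> matches all sets of \<open>F\<close> at once.
    The family is left arbitrary because the statement is used for several families below.\<close>
  have key: "AE s in Q. \<exists>c\<in>C. \<forall>A\<in>F. lim_freq A s = measure c A" if F: "countable F" "F \<subseteq> sets S" for F
  proof -
    have "AE \<omega> in M'. \<forall>x\<in>XX. X 1 \<omega> = x \<longrightarrow> x \<in> XX1"
    proof (subst AE_ball_countable[OF XX(1)], intro ballI)
      fix x assume x: "x \<in> XX"
      show "AE \<omega> in M'. X 1 \<omega> = x \<longrightarrow> x \<in> XX1"
      proof (cases "x \<in> XX1")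
        case False
        with x have "\<P>(\<omega> in M'. X 1 \<omega> = x) = 0" by (auto simp: XX1_def not_less measure_le_0_iff)
        then have "AE \<omega> in M'. X 1 \<omega> \<noteq> x"
          by (intro AE_iff_measurable[THEN iffD2]) (auto simp: emeasure_eq_measure)
        then show ?thesis by eventually_elim auto
      qed simp
    qed
    moreover have "AE \<omega> in M'. \<forall>x\<in>XX1. \<forall>A\<in>F. X 1 \<omega> = x \<longrightarrow> lim_freq A (\<lambda>i. Y' i \<omega>) = measure (\<nu> x) A"
    proof (subst AE_ball_countable[OF XX1], intro ballI, subst AE_ball_countable[OF F(1)], intro ballI)
      fix x A assume x: "x \<in> XX1" and "A \<in> F"
      then have A: "A \<in> sets S" using F by auto
      show "AE \<omega> in M'. X 1 \<omega> = x \<longrightarrow> lim_freq A (\<lambda>i. Y' i \<omega>) = measure (\<nu> x) A"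
        using AE_lim_freq_eq[OF A conv[OF A] recAE[OF x]] x by (simp add: \<nu>_eq[OF x A] XX1_def)
    qed
    ultimately have "AE \<omega> in M'. \<exists>c\<in>C. \<forall>A\<in>F. lim_freq A (\<lambda>i. Y' i \<omega>) = measure c A"
      using AE_space
    proof eventually_elim
      case (elim \<omega>)
      then have "X 1 \<omega> \<in> XX1" using X_in by blast
      with elim show ?case by (auto simp: C_def)
    qed
    \<comment> \<open>Measurability of this set permits the passage from \<open>M'\<close> to the
      law \<open>Q\<close>.\<close>
    moreover have "{s \<in> space ?S. \<exists>c\<in>C. \<forall>A\<in>F. lim_freq A s = measure c A} \<in> sets ?S"
    proof -
      have "{s \<in> space ?S. lim_freq A s = measure c A} \<in> sets ?S" if "A \<in> F" for A c
      proof -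
        have [measurable]: "A \<in> sets S" using F that by auto
        show ?thesis by measurable
      qed
      then have "(\<Union>c\<in>C. {s \<in> space ?S. \<forall>A\<in>F. lim_freq A s = measure c A}) \<in> sets ?S"
        using F C by (intro sets.countable_UN' sets_Collect_ball_countable) auto
      also have "(\<Union>c\<in>C. {s \<in> space ?S. \<forall>A\<in>F. lim_freq A s = measure c A})
          = {s \<in> space ?S. \<exists>c\<in>C. \<forall>A\<in>F. lim_freq A s = measure c A}" by auto
      finally show ?thesis .
    qed
    ultimately show ?thesis
      unfolding Q' by (subst AE_distr_iff[OF mY'])
  qed
  have C0: "C \<noteq> {}" using key[of "{}"] by auto
  obtain F where F: "countable F" "F \<subseteq> sets S"
    and sep: "\<And>c d. c \<in> C \<Longrightarrow> d \<in> C \<Longrightarrow> (\<And>A. A \<in> F \<Longrightarrow> measure c A = measure d A) \<Longrightarrow> c = d"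
    using ex_countable_separating_sets[OF C] by metis
  define p where "p s = decode F C (\<lambda>A. lim_freq A s)" for s
  have pC: "p \<in> measurable ?S (count_space C)"
  proof -
    have "lim_freq A \<in> borel_measurable ?S" if "A \<in> F" for A
    proof -
      have [measurable]: "A \<in> sets S" using F that by auto
      show ?thesis by measurable
    qed
    then show ?thesis unfolding p_def by (intro measurable_decode C C0 F sep)
  qed
  have pP[measurable]: "p \<in> measurable ?S (prob_algebra S)"
    using pC by (rule measurable_compose) (use C in auto)
  have p_transpose: "p (s \<circ> Transposition.transpose i j) = p s" for s i j
    unfolding p_def lim_freq_transpose ..
  have p_lim: "AE s in Q. lim_freq A s = measure (p s) A" if "A \<in> sets S" for A
  proof -
    \<comment> \<open>The sets in \<open>F\<close> already force \<open>c\<close> to be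
      \<open>p s\<close>; adjoining \<open>A\<close> makes the same measure give the frequency of
      \<open>A\<close>. The null set may depend on \<open>A\<close>.\<close>
    have "AE s in Q. \<exists>c\<in>C. \<forall>A\<in>insert A F. lim_freq A s = measure c A"
      using F that by (intro key) auto
    then show ?thesis
    proof eventually_elim
      case (elim s)
      then obtain c where "c \<in> C" "\<forall>A\<in>insert A F. lim_freq A s = measure c A" by blast
      moreover from this have "p s = c" unfolding p_def by (intro decode_eq sep) auto
      ultimately show ?case by simp
    qed
  qed
  define P where "P \<omega> = p (\<lambda>n. Y n \<omega>)" for \<omega>
  have P: "P \<in> measurable M (prob_algebra S)"
    unfolding P_def using mY pP by (rule measurable_compose)
  define G where "G = vimage_algebra (space M) P (prob_algebra S)"
  interpret G: sigma_finite_subalgebra M G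
    unfolding G_def using M P by (rule sigma_finite_subalgebra_vimage)
  have PG: "P \<in> measurable G (prob_algebra S)"
    unfolding G_def using measurable_space[OF P] by (intro measurable_vimage_algebra1) auto
  have "iid_mixture_by M S Y P"
    unfolding iid_mixture_by_def G_def[symmetric]
  proof (intro conjI allI impI P)
    fix N :: nat and A :: "nat \<Rightarrow> 's set"
    assume A: "\<forall>i\<le>N. A i \<in> sets S"
    define E where "E = {\<omega> \<in> space M. \<forall>i\<le>N. Y i \<omega> \<in> A i}"
    let ?g = "\<lambda>\<omega>. \<Prod>i\<le>N. measure (P \<omega>) (A i)"
    have Em[measurable]: "E \<in> sets M"
      unfolding E_def
    proof (rule sets.sets_Collect_countable_All[where 'i=nat])
      show "{\<omega> \<in> space M. i \<le> N \<longrightarrow> Y i \<omega> \<in> A i} \<in> sets M" for i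
        using A measurable_sets[OF Y, of "A i" i]
        by (cases "i \<le> N") (simp_all add: vimage_def Int_def conj_commute)
    qed
    have gG: "?g \<in> borel_measurable G"
      using A by (intro borel_measurable_prod measurable_compose[OF PG] measurable_measure_prob_algebra) auto
    have gM[measurable]: "?g \<in> borel_measurable M"
      using G.subalg gG by (rule measurable_from_subalg)
    show "AE \<omega> in M. real_cond_exp M G (indicator {\<omega> \<in> space M. \<forall>i\<le>N. Y i \<omega> \<in> A i}) \<omega> = ?g \<omega>"
      unfolding E_def[symmetric]
    proof (rule G.real_cond_exp_charact[OF _ _ _ gG])
      show "integrable M (indicator E :: _ \<Rightarrow> real)"
        by (rule M.integrable_const_bound[where B=1]) auto
      have "\<bar>?g \<omega>\<bar> \<le> 1" if "\<omega> \<in> space M" for \<omega>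
      proof -
        interpret p: prob_space "P \<omega>"
          using measurable_space[OF P that] by (simp add: space_prob_algebra)
        show ?thesis unfolding abs_prod by (intro prod_le_1) auto
      qed
      then show "integrable M ?g"
        by (intro M.integrable_const_bound[where B=1]) auto
      fix D assume "D \<in> sets G"
      then obtain B where B[measurable]: "B \<in> sets (prob_algebra S)" and D: "D = P -` B \<inter> space M"
        using measurable_space[OF P] by (auto simp: G_def sets_vimage_algebra2)
      have Am: "A i \<in> sets S" if "i < Suc N" for i using A that by auto
      \<comment> \<open>An event of \<sigma>(P) is a condition on \<open>p\<close>, which is
        invariant under transpositions. Its indicator can thus serve as the symmetric factor
        \<open>\<Phi>\<close> in the de Finetti identity.\<close>
      let ?h = "\<lambda>s. indicator B (p s) :: real"
      have hm: "?h \<in> borel_measurable ?S" by measurable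
      have m1: "(\<lambda>s. (\<Prod>i<Suc N. indicator (A i) (s i)) * ?h s) \<in> borel_measurable ?S"
        using Am by (intro borel_measurable_times borel_measurable_prod hm) auto
      have m2: "(\<lambda>s. (\<Prod>i<Suc N. lim_freq (A i) s) * ?h s) \<in> borel_measurable ?S"
        using Am by (intro borel_measurable_times borel_measurable_prod hm measurable_lim_freq[where S=S]) auto
      have m3: "(\<lambda>s. (\<Prod>i<Suc N. measure (p s) (A i)) * ?h s) \<in> borel_measurable ?S"
        using Am by (intro borel_measurable_times borel_measurable_prod hm
            measurable_compose[OF pP] measurable_measure_prob_algebra) auto
      have "(\<integral>\<omega>\<in>D. indicator E \<omega> \<partial>M)
          = (\<integral>\<omega>. (\<Prod>i<Suc N. indicator (A i) (Y i \<omega>)) * ?h (\<lambda>n. Y n \<omega>) \<partial>M)"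
        unfolding set_lebesgue_integral_def
      proof (rule Bochner_Integration.integral_cong[OF refl])
        fix \<omega> assume \<omega>: "\<omega> \<in> space M"
        have "(\<Prod>i<Suc N. indicator (A i) (Y i \<omega>) :: real) = indicator E \<omega>"
        proof (cases "\<omega> \<in> E")
          case True then show ?thesis by (auto simp: E_def indicator_def)
        next
          case False
          with \<omega> obtain i where "i \<le> N" "Y i \<omega> \<notin> A i" by (auto simp: E_def)
          then have "(\<Prod>i<Suc N. indicator (A i) (Y i \<omega>) :: real) = 0"
            by (intro prod_zero) (auto intro!: bexI[of _ i])
          with False show ?thesis by simp
        qed
        with \<omega> show "indicator D \<omega> *\<^sub>R (indicator E \<omega> :: real)
            = (\<Prod>i<Suc N. indicator (A i) (Y i \<omega>)) * ?h (\<lambda>n. Y n \<omega>)"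
          by (simp add: D P_def indicator_def)
      qed
      also have "\<dots> = (\<integral>s. (\<Prod>i<Suc N. indicator (A i) (s i)) * ?h s \<partial>Q)"
        unfolding Q_def by (rule integral_distr[OF mY m1, symmetric])
      also have "\<dots> = (\<integral>s. (\<Prod>i<Suc N. lim_freq (A i) s) * ?h s \<partial>Q)"
        by (rule Q.integral_prod_indicator_eq_lim_freq[where c=1, OF Am])
           (use hm in \<open>auto simp: Q_def p_transpose[unfolded comp_def] comp_def indicator_def\<close>)
      also have "\<dots> = (\<integral>s. (\<Prod>i<Suc N. measure (p s) (A i)) * ?h s \<partial>Q)"
      proof (rule integral_cong_AE)
        have "AE s in Q. \<forall>i\<in>{..<Suc N}. lim_freq (A i) s = measure (p s) (A i)"
          using Am by (intro AE_ball_countable[THEN iffD2] ballI p_lim) auto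
        then show "AE s in Q. (\<Prod>i<Suc N. lim_freq (A i) s) * ?h s = (\<Prod>i<Suc N. measure (p s) (A i)) * ?h s"
          by eventually_elim simp
      qed (use m2 m3 in \<open>simp_all add: Q_def\<close>)
      also have "\<dots> = (\<integral>\<omega>. (\<Prod>i<Suc N. measure (P \<omega>) (A i)) * indicator B (P \<omega>) \<partial>M)"
        unfolding Q_def P_def by (rule integral_distr[OF mY m3])
      also have "\<dots> = (\<integral>\<omega>\<in>D. ?g \<omega> \<partial>M)"
        unfolding set_lebesgue_integral_def lessThan_Suc_atMost
        by (intro Bochner_Integration.integral_cong) (auto simp: D indicator_def)
      finally show "(\<integral>\<omega>\<in>D. indicator E \<omega> \<partial>M) = (\<integral>\<omega>\<in>D. ?g \<omega> \<partial>M)" .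
    qed
  qed
  moreover have "AE \<omega> in M. P \<omega> \<in> C"
    using measurable_space[OF measurable_compose[OF mY pC]] by (auto simp: P_def)
  ultimately show ?thesis
    unfolding countable_iid_mixture_def using C by blast
qed

theorem theorem4p2:
  fixes M :: "'w measure" and Y :: "nat \<Rightarrow> 'w \<Rightarrow> 's :: polish_space"
  assumes "prob_space M"
    and "\<And>n. Y n \<in> measurable M borel"
    and "exchangeable M borel Y"
  shows "countable_iid_mixture M borel Y \<longleftrightarrow> recurrent_hmm M borel Y"
  using countable_iid_mixture_imp_recurrent_hmm[where Y=Y, OF assms(1,2)]
    recurrent_hmm_imp_countable_iid_mixture[OF assms] by blast

end
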